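(* Let $\alpha\ge1$ be real, set $$p_\alpha=\frac{2}{\max\{\alpha,2\}},\qquad q_\alpha=\frac{4-p_\alpha}{4+p_\alpha},$$ and let $a_\alpha>0$ be a constant such that, for every integer $k\ne0$ and every $f_k^{in}\in H^1$, the solution $f_k(t,r)=e^{-iktr^\alpha}f_k^{in}(r)$ of $\partial_tf_k+ikr^\alpha f_k=0$ satisfies $\|f_k(t)\|_{H^{-1}}\le a_\alpha(1+|k|t)^{-p_\alpha}\|f_k^{in}\|_{H^1}$ for all $t\ge0$ (such a constant exists). Then for every integer $k\ne0$, every $\nu\in(0,1)$ with $\nu|k|^{-1}<1$, and every $f_k^{in}\in H$, the solution $f_k^\nu$ of $$\partial_tf_k^\nu+ikr^\alpha f_k^\nu=\nu\Delta_kf_k^\nu,\quad r\in[0,1),\ t\ge0,\qquad f_k^\nu(0)=f_k^{in},\qquad \partial_rf_k^\nu(t,1)=0,$$ satisfies $$\|f_k^\nu(t)\|_H\le e^{-c_\alpha\nu^{q_\alpha}|k|^{1-q_\alpha}t}\,\|f_k^{in}\|_H,\qquad\forall t>\frac{1}{\nu^{q_\alpha}|k|^{1-q_\alpha}},$$ with $$c_\alpha=\frac{1}{128}\min\left\{\frac{1}{64(1+\alpha^2)},\frac{1}{a_\alpha4^{p_\alpha}}\right\}.$$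
   Context: $\Delta_k=\partial_{rr}+\frac1r\partial_r-\frac{k^2}{r^2}$. For fixed integer $k\ne0$, the spaces of functions $\phi:[0,1)\to\mathbb{C}$ are: $H$ with norm $\|\phi\|_H^2=\int_0^1|\phi(r)|^2r\,dr$; $H^1=H^1_k$ with norm $\|\phi\|_{H^1}^2=\int_0^1\left[|\partial_r\phi(r)|^2+\frac{k^2}{r^2}|\phi(r)|^2\right]r\,dr$; and the dual norm $\|\phi\|_{H^{-1}}=\sup_{\eta\in H^1,\,\|\eta\|_{H^1}=1}\left|\int_0^1\phi(r)\overline{\eta(r)}\,r\,dr\right|$ (the $H^1$ and $H^{-1}$ norms depend on $k$). The viscous equation is the $k$-th angular Fourier mode, in polar coordinates on the unit disk, of the advection-diffusion equation $\partial_tf^\nu+\boldsymbol{u}\cdot\nabla f^\nu=\nu\Delta f^\nu$ with $\boldsymbol{u}(r,\theta)=r^{1+\alpha}(-\sin\theta,\cos\theta)$ and no-flux boundary condition. *)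

theory Defs
  imports "HOL-Analysis.Analysis"
begin

text \<open>
  Radial profiles are functions \<open>real \<Rightarrow> complex\<close> of which only the values on the open
  interval \<open>(0,1)\<close> matter (the endpoint \<open>r = 0\<close> of \<open>[0,1)\<close> is a null set).
\<close>

definition rderiv :: "(real \<Rightarrow> complex) \<Rightarrow> real \<Rightarrow> complex"
  where "rderiv \<phi> r = vector_derivative \<phi> (at r)"

text \<open>
  Local absolute continuity on \<open>(0,1)\<close>, stated as the fundamental theorem of calculus for Lebesgue
  integrals.  At points where \<open>\<phi>\<close> is not differentiable \<open>rderiv \<phi>\<close> has an unspecified value, but
  the two conditions force \<open>\<phi>\<close> to be differentiable almost everywhere with derivative \<open>rderiv \<phi>\<close>.
\<close>

definition locally_ac :: "(real \<Rightarrow> complex) \<Rightarrow> bool"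
  where "locally_ac \<phi> \<longleftrightarrow>
    (\<forall>a b. 0 < a \<and> a \<le> b \<and> b < 1 \<longrightarrow>
      set_integrable lebesgue {a..b} (rderiv \<phi>) \<and>
      (LINT r:{a..b}|lebesgue. rderiv \<phi> r) = \<phi> b - \<phi> a)"

definition H_space :: "(real \<Rightarrow> complex) set"
  where "H_space = {\<phi>. set_borel_measurable lebesgue {0<..<1} \<phi> \<and>
    set_integrable lebesgue {0<..<1} (\<lambda>r. (cmod (\<phi> r))\<^sup>2 * r)}"

definition H_norm :: "(real \<Rightarrow> complex) \<Rightarrow> real"
  where "H_norm \<phi> = sqrt (LINT r:{0<..<1}|lebesgue. (cmod (\<phi> r))\<^sup>2 * r)"

definition H_inner :: "(real \<Rightarrow> complex) \<Rightarrow> (real \<Rightarrow> complex) \<Rightarrow> complex"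
  where "H_inner \<phi> \<eta> = (LINT r:{0<..<1}|lebesgue. \<phi> r * cnj (\<eta> r) * of_real r)"

text \<open>
  Each class in \<open>H\<^sup>1\<^sub>k\<close> is represented by its locally absolutely continuous member.  No condition is
  imposed at \<open>r = 1\<close>, as the boundary condition of the problem is of Neumann type.
\<close>

definition H1_space :: "int \<Rightarrow> (real \<Rightarrow> complex) set"
  where "H1_space k = {\<phi>. locally_ac \<phi> \<and>
    set_integrable lebesgue {0<..<1}
      (\<lambda>r. ((cmod (rderiv \<phi> r))\<^sup>2 + (of_int k)\<^sup>2 / r\<^sup>2 * (cmod (\<phi> r))\<^sup>2) * r)}"

definition H1_norm :: "int \<Rightarrow> (real \<Rightarrow> complex) \<Rightarrow> real"
  where "H1_norm k \<phi> = sqrt (LINT r:{0<..<1}|lebesgue.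
    ((cmod (rderiv \<phi> r))\<^sup>2 + (of_int k)\<^sup>2 / r\<^sup>2 * (cmod (\<phi> r))\<^sup>2) * r)"

definition Hm1_norm :: "int \<Rightarrow> (real \<Rightarrow> complex) \<Rightarrow> ereal"
  where "Hm1_norm k \<phi> =
    (SUP \<eta> \<in> {\<eta> \<in> H1_space k. H1_norm k \<eta> = 1}. ereal (cmod (H_inner \<phi> \<eta>)))"

definition inviscid :: "real \<Rightarrow> int \<Rightarrow> (real \<Rightarrow> complex) \<Rightarrow> real \<Rightarrow> real \<Rightarrow> complex"
  where "inviscid \<alpha> k f t r = exp (- \<i> * of_int k * of_real t * of_real (r powr \<alpha>)) * f r"

definition laplace_k :: "int \<Rightarrow> (real \<Rightarrow> complex) \<Rightarrow> real \<Rightarrow> complex"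
  where "laplace_k k \<phi> r =
    rderiv (rderiv \<phi>) r + rderiv \<phi> r / of_real r - of_real ((of_int k)\<^sup>2 / r\<^sup>2) * \<phi> r"

text \<open>
  The domain in \<open>H\<close> of the Neumann realisation of \<open>\<Delta>\<^sub>k\<close>.  Its elements are continuously
  differentiable on \<open>(0,1)\<close>, and the derivative at \<open>r = 1\<close> is read as the limit of \<open>rderiv \<phi> r\<close>
  from the left.
\<close>

definition neumann_domain :: "int \<Rightarrow> (real \<Rightarrow> complex) set"
  where "neumann_domain k = {\<phi> \<in> H1_space k.
    locally_ac (rderiv \<phi>) \<and> laplace_k k \<phi> \<in> H_space \<and> (rderiv \<phi> \<longlongrightarrow> 0) (at_left 1)}"

definition adv_diff_rhs :: "real \<Rightarrow> int \<Rightarrow> real \<Rightarrow> (real \<Rightarrow> complex) \<Rightarrow> real \<Rightarrow> complex"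
  where "adv_diff_rhs \<alpha> k \<nu> \<phi> r =
    of_real \<nu> * laplace_k k \<phi> r - \<i> * of_int k * of_real (r powr \<alpha>) * \<phi> r"

text \<open>
  Solutions with initial datum in \<open>H\<close> are classical solutions in the sense of semigroup theory:
  continuous into \<open>H\<close> for \<open>t \<ge> 0\<close>, in the domain and continuously differentiable into \<open>H\<close>
  for \<open>t > 0\<close>, with the equation holding in \<open>H\<close> for \<open>t > 0\<close>.  The operator generates an analytic
  semigroup on \<open>H\<close>, so every \<open>f\<^sub>0 \<in> H\<close> has exactly one such solution (up to null sets at \<open>t = 0\<close>).
  The last two conditions say that the difference quotients in \<open>t\<close> converge in \<open>H\<close> to the
  right-hand side, and that the latter is continuous in time.
\<close>

definition viscous_solution ::
    "real \<Rightarrow> int \<Rightarrow> real \<Rightarrow> (real \<Rightarrow> complex) \<Rightarrow> (real \<Rightarrow> real \<Rightarrow> complex) \<Rightarrow> bool"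
  where "viscous_solution \<alpha> k \<nu> f\<^sub>0 f \<longleftrightarrow>
    (\<forall>t\<ge>0. f t \<in> H_space) \<and>
    (AE r in lebesgue. r \<in> {0<..<1} \<longrightarrow> f 0 r = f\<^sub>0 r) \<and>
    (\<forall>t\<ge>0. ((\<lambda>s. H_norm (\<lambda>r. f s r - f t r)) \<longlongrightarrow> 0) (at t within {0..})) \<and>
    (\<forall>t>0. f t \<in> neumann_domain k) \<and>
    (\<forall>t>0. ((\<lambda>h. H_norm (\<lambda>r. (f (t + h) r - f t r) / of_real h - adv_diff_rhs \<alpha> k \<nu> (f t) r))
             \<longlongrightarrow> 0) (at 0)) \<and>
    (\<forall>t>0. ((\<lambda>s. H_norm (\<lambda>r. adv_diff_rhs \<alpha> k \<nu> (f s) r - adv_diff_rhs \<alpha> k \<nu> (f t) r))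
             \<longlongrightarrow> 0) (at t))"

definition p_exp :: "real \<Rightarrow> real"
  where "p_exp \<alpha> = 2 / max \<alpha> 2"

definition q_exp :: "real \<Rightarrow> real"
  where "q_exp \<alpha> = (4 - p_exp \<alpha>) / (4 + p_exp \<alpha>)"

definition mixing_bound :: "real \<Rightarrow> real \<Rightarrow> bool"
  where "mixing_bound \<alpha> a \<longleftrightarrow>
    (\<forall>k::int. k \<noteq> 0 \<longrightarrow> (\<forall>f \<in> H1_space k. \<forall>t\<ge>0.
      Hm1_norm k (inviscid \<alpha> k f t) \<le>
        ereal (a * (1 + \<bar>of_int k\<bar> * t) powr (- p_exp \<alpha>) * H1_norm k f)))"

definition c_rate :: "real \<Rightarrow> real \<Rightarrow> real"
  where "c_rate \<alpha> a = 1 / 128 * min (1 / (64 * (1 + \<alpha>\<^sup>2))) (1 / (a * 4 powr p_exp \<alpha>))"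

end

theory Submission
  imports Defs
begin

text \<open>
  Write \<open>N(t)\<close> and \<open>E(t)\<close> for the squared \<open>H\<close> and \<open>H\<^sup>1\<close> norms of the viscous solution, so that
  \<open>N' = - 2 \<nu> E\<close>.  If \<open>N\<close> loses only a small fraction of its value on a window of length \<open>2 \<tau>\<close>,
  then the mean value theorem gives times \<open>t\<^sub>1 < t\<^sub>2\<close> in the window, at distance comparable to
  \<open>\<tau>\<close>, at which \<open>E\<close> is small.  Let \<open>g\<close> be the inviscid solution that starts from \<open>f(t\<^sub>1)\<close>.  The transport
  terms cancel in the derivative of the correlation \<open>\<langle>f, g\<rangle>\<close>, which is therefore \<open>- \<nu> \<langle>f, g\<rangle>\<close> in the
  \<open>H\<^sup>1\<close> pairing; as \<open>g\<close> grows only linearly in \<open>H\<^sup>1\<close>, the correlation stays close to \<open>N(t\<^sub>1)\<close>.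
  On the other hand, mixing bounds it at \<open>t\<^sub>2\<close> by the \<open>H\<^sup>-\<^sup>1\<close> norm of \<open>g\<close> times the small \<open>H\<^sup>1\<close> norm of \<open>f\<close>,
  a contradiction.  With \<open>x = \<nu> / |k|\<close>, the choice \<open>|k| \<tau> = x powr (- 2 / (4 + p)) / 2\<close>
  balances the two estimates, and iterating over consecutive windows gives the rate.
\<close>

section \<open>The weighted space \<open>H\<close>\<close>

text \<open>Restricting the measure, rather than carrying an indicator in every integrand, lets the
  general results on \<open>integrable\<close> and \<open>integral_mono\<close> apply as they stand.
  The weight \<open>r\<close> stays in the integrand, as in the given definitions.\<close>

abbreviation leb01 :: "real measure"
  where "leb01 \<equiv> restrict_space lebesgue {0<..<1}"

lemma space_leb01 [simp]: "space leb01 = {0<..<1}"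
  by (simp add: space_restrict_space)

lemma H_space_iff:
  "\<phi> \<in> H_space \<longleftrightarrow> \<phi> \<in> borel_measurable leb01 \<and> integrable leb01 (\<lambda>r. (cmod (\<phi> r))\<^sup>2 * r)"
  unfolding H_space_def set_borel_measurable_def set_integrable_def
  by (simp add: borel_measurable_restrict_space_iff integrable_restrict_space)

lemma H_norm_eq: "H_norm \<phi> = sqrt (\<integral>r. (cmod (\<phi> r))\<^sup>2 * r \<partial>leb01)"
  unfolding H_norm_def set_lebesgue_integral_def by (simp add: integral_restrict_space)

lemma H_inner_eq: "H_inner \<phi> \<eta> = (\<integral>r. \<phi> r * cnj (\<eta> r) * of_real r \<partial>leb01)"
  unfolding H_inner_def set_lebesgue_integral_def by (simp add: integral_restrict_space)

definition H1_density :: "int \<Rightarrow> (real \<Rightarrow> complex) \<Rightarrow> real \<Rightarrow> real"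
  where "H1_density k \<phi> r =
    ((cmod (rderiv \<phi> r))\<^sup>2 + (of_int k)\<^sup>2 / r\<^sup>2 * (cmod (\<phi> r))\<^sup>2) * r"

lemma H1_space_iff: "\<phi> \<in> H1_space k \<longleftrightarrow> locally_ac \<phi> \<and> integrable leb01 (H1_density k \<phi>)"
  unfolding H1_space_def set_integrable_def H1_density_def[abs_def]
  by (simp add: integrable_restrict_space)

lemma H1_norm_eq: "H1_norm k \<phi> = sqrt (integral\<^sup>L leb01 (H1_density k \<phi>))"
  unfolding H1_norm_def set_lebesgue_integral_def H1_density_def[abs_def]
  by (simp add: integral_restrict_space)

lemma AE_leb01: "AE r in leb01. 0 < r \<and> r < 1"
  by (rule AE_I2) auto

lemma measurable_ident_leb01 [measurable]: "(\<lambda>r. r) \<in> borel_measurable leb01"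
  by (rule measurable_restrict_space1) (simp add: measurable_completion)

lemma measurable_of_real_leb01 [measurable]: "complex_of_real \<in> borel_measurable leb01"
  using measurable_compose[OF measurable_ident_leb01 borel_measurable_of_real] by simp

lemma borel_measurable_cnj [measurable]: "cnj \<in> borel_measurable borel"
  by (intro borel_measurable_continuous_onI continuous_intros)

text \<open>Continuity gives Borel measurability on the interval; the identity map is measurable
  from the Lebesgue to the Borel sets and carries this over.\<close>

lemma borel_measurable_leb01_continuous:
  fixes g :: "real \<Rightarrow> 'a::topological_space"
  assumes "continuous_on {0<..<1} g"
  shows "g \<in> borel_measurable leb01"
proof -
  have 1: "g \<in> borel_measurable (restrict_space borel {0<..<1})"
    using assms by (rule borel_measurable_continuous_on_restrict)
  have "(\<lambda>r. r) \<in> leb01 \<rightarrow>\<^sub>M restrict_space borel {0<..<1}"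
    by (rule measurable_restrict_space2) auto
  from measurable_compose[OF this 1] show ?thesis .
qed

lemma H_inner_integrable:
  assumes "x \<in> H_space" "y \<in> H_space"
  shows "integrable leb01 (\<lambda>r. x r * cnj (y r) * of_real r)"
proof (rule Bochner_Integration.integrable_bound)
  show "integrable leb01 (\<lambda>r. (cmod (x r))\<^sup>2 * r + (cmod (y r))\<^sup>2 * r)"
    using assms by (auto simp: H_space_iff)
  have [measurable]: "x \<in> borel_measurable leb01" "y \<in> borel_measurable leb01"
    using assms by (auto simp: H_space_iff)
  show "(\<lambda>r. x r * cnj (y r) * of_real r) \<in> borel_measurable leb01"
    by measurable
  show "AE r in leb01. norm (x r * cnj (y r) * of_real r)
      \<le> norm ((cmod (x r))\<^sup>2 * r + (cmod (y r))\<^sup>2 * r)"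
    using AE_leb01
  proof eventually_elim
    case (elim r)
    have "cmod (x r) * cmod (y r) \<le> (cmod (x r))\<^sup>2 + (cmod (y r))\<^sup>2"
      using sum_squares_bound[of "cmod (x r)" "cmod (y r)"]
        mult_nonneg_nonneg[OF norm_ge_zero norm_ge_zero, of "x r" "y r"]
      by linarith
    then have "cmod (x r) * cmod (y r) * r \<le> ((cmod (x r))\<^sup>2 + (cmod (y r))\<^sup>2) * r"
      using elim by (intro mult_right_mono) auto
    then show ?case using elim
      by (simp add: norm_mult distrib_right)
  qed
qed

text \<open>Serves all multipliers that occur: constants, the potential and the phase of the
  inviscid flow.\<close>

lemma H_space_bounded_mult:
  assumes "x \<in> H_space" "m \<in> borel_measurable leb01" "\<And>r. 0 < r \<Longrightarrow> r < 1 \<Longrightarrow> cmod (m r) \<le> C"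
  shows "(\<lambda>r. m r * x r) \<in> H_space"
  unfolding H_space_iff
proof
  have [measurable]: "x \<in> borel_measurable leb01" "m \<in> borel_measurable leb01"
    using assms by (auto simp: H_space_iff)
  show "(\<lambda>r. m r * x r) \<in> borel_measurable leb01" by measurable
  show "integrable leb01 (\<lambda>r. (cmod (m r * x r))\<^sup>2 * r)"
  proof (rule Bochner_Integration.integrable_bound)
    show "integrable leb01 (\<lambda>r. C\<^sup>2 * ((cmod (x r))\<^sup>2 * r))"
      using assms by (auto simp: H_space_iff)
    show "AE r in leb01. norm ((cmod (m r * x r))\<^sup>2 * r) \<le> norm (C\<^sup>2 * ((cmod (x r))\<^sup>2 * r))"
      using AE_leb01
    proof eventually_elim
      case (elim r)
      then have "(cmod (m r))\<^sup>2 \<le> C\<^sup>2"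
        using assms(3) by (intro power_mono) auto
      then have "(cmod (m r))\<^sup>2 * ((cmod (x r))\<^sup>2 * r) \<le> C\<^sup>2 * ((cmod (x r))\<^sup>2 * r)"
        using elim by (intro mult_right_mono) auto
      then show ?case using elim by (simp add: norm_mult power_mult_distrib mult_ac)
    qed
  qed measurable
qed

lemma H_space_scale: "x \<in> H_space \<Longrightarrow> (\<lambda>r. c * x r) \<in> H_space"
  by (rule H_space_bounded_mult) auto

lemma H_space_add:
  assumes "x \<in> H_space" "y \<in> H_space"
  shows "(\<lambda>r. x r + y r) \<in> H_space"
  unfolding H_space_iff
proof
  have [measurable]: "x \<in> borel_measurable leb01" "y \<in> borel_measurable leb01"
    using assms by (auto simp: H_space_iff)
  show "(\<lambda>r. x r + y r) \<in> borel_measurable leb01" by measurable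
  show "integrable leb01 (\<lambda>r. (cmod (x r + y r))\<^sup>2 * r)"
  proof (rule Bochner_Integration.integrable_bound)
    show "integrable leb01 (\<lambda>r. 2 * ((cmod (x r))\<^sup>2 * r) + 2 * ((cmod (y r))\<^sup>2 * r))"
      using assms by (auto simp: H_space_iff)
    show "AE r in leb01. norm ((cmod (x r + y r))\<^sup>2 * r)
        \<le> norm (2 * ((cmod (x r))\<^sup>2 * r) + 2 * ((cmod (y r))\<^sup>2 * r))"
      using AE_leb01
    proof eventually_elim
      case (elim r)
      have "(cmod (x r + y r))\<^sup>2 \<le> (cmod (x r) + cmod (y r))\<^sup>2"
        by (intro power_mono norm_triangle_ineq) auto
      also have "\<dots> \<le> 2 * (cmod (x r))\<^sup>2 + 2 * (cmod (y r))\<^sup>2"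
        using sum_squares_bound[of "cmod (x r)" "cmod (y r)"] by (simp add: power2_sum)
      finally have "(cmod (x r + y r))\<^sup>2 * r \<le> (2 * (cmod (x r))\<^sup>2 + 2 * (cmod (y r))\<^sup>2) * r"
        using elim by (intro mult_right_mono) auto
      then show ?case using elim by (simp add: distrib_right)
    qed
  qed measurable
qed

lemma H_space_diff: "x \<in> H_space \<Longrightarrow> y \<in> H_space \<Longrightarrow> (\<lambda>r. x r - y r) \<in> H_space"
  using H_space_add[of x "\<lambda>r. -1 * y r"] H_space_scale[of y "-1"] by simp

lemma H_inner_add_left:
  "x \<in> H_space \<Longrightarrow> y \<in> H_space \<Longrightarrow> z \<in> H_space \<Longrightarrow>
    H_inner (\<lambda>r. x r + y r) z = H_inner x z + H_inner y z"
  unfolding H_inner_eq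
  by (subst Bochner_Integration.integral_add[symmetric]) (simp_all add: H_inner_integrable distrib_right)

lemma H_inner_scale_left: "H_inner (\<lambda>r. c * x r) z = c * H_inner x z"
  unfolding H_inner_eq by (subst integral_mult_right_zero[symmetric]) (simp add: mult_ac)

lemma H_inner_cnj: "H_inner y x = cnj (H_inner x y)"
  unfolding H_inner_eq Bochner_Integration.integral_cnj[symmetric] by (simp add: mult_ac)

lemma H_inner_scale_right: "H_inner x (\<lambda>r. c * z r) = cnj c * H_inner x z"
  using H_inner_scale_left[of c z x] by (metis H_inner_cnj complex_cnj_mult)

lemma H_inner_add_right:
  "x \<in> H_space \<Longrightarrow> y \<in> H_space \<Longrightarrow> z \<in> H_space \<Longrightarrow>
    H_inner z (\<lambda>r. x r + y r) = H_inner z x + H_inner z y"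
  using H_inner_add_left[of x y z] by (metis H_inner_cnj complex_cnj_add)

lemma H_inner_diff_left:
  "x \<in> H_space \<Longrightarrow> y \<in> H_space \<Longrightarrow> z \<in> H_space \<Longrightarrow>
    H_inner (\<lambda>r. x r - y r) z = H_inner x z - H_inner y z"
  using H_inner_add_left[of x "\<lambda>r. -1 * y r" z] H_space_scale[of y "-1"] H_inner_scale_left[of "-1" y z]
  by simp

lemma H_inner_diff_right:
  "x \<in> H_space \<Longrightarrow> y \<in> H_space \<Longrightarrow> z \<in> H_space \<Longrightarrow>
    H_inner z (\<lambda>r. x r - y r) = H_inner z x - H_inner z y"
  using H_inner_diff_left[of x y z] by (metis H_inner_cnj complex_cnj_diff)

section \<open>Norm, Cauchy-Schwarz inequality and limits of inner products\<close>

lemma H_norm_nonneg [simp]: "0 \<le> H_norm x"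
  unfolding H_norm_eq by (intro real_sqrt_ge_zero integral_nonneg_AE) (auto intro!: AE_I2)

lemma H_norm_power2: "(H_norm x)\<^sup>2 = (\<integral>r. (cmod (x r))\<^sup>2 * r \<partial>leb01)"
  unfolding H_norm_eq by (intro real_sqrt_pow2 integral_nonneg_AE) (auto intro!: AE_I2)

lemma H_inner_self: "H_inner x x = of_real ((H_norm x)\<^sup>2)"
proof -
  have "H_inner x x = (\<integral>r. of_real ((cmod (x r))\<^sup>2 * r) \<partial>leb01)"
    unfolding H_inner_eq by (intro Bochner_Integration.integral_cong) (simp_all only: complex_norm_square[symmetric] of_real_mult)
  also have "\<dots> = of_real ((H_norm x)\<^sup>2)"
    unfolding H_norm_power2 by (rule integral_complex_of_real)
  finally show ?thesis .
qed

text \<open>\<open>H_norm\<close> is only a seminorm on functions, so the square of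
  \<open>x - c y\<close> is expanded directly and the case of vanishing \<open>H_norm y\<close> is
  treated apart.\<close>

lemma H_Cauchy_Schwarz:
  assumes "x \<in> H_space" "y \<in> H_space"
  shows "cmod (H_inner x y) \<le> H_norm x * H_norm y"
proof -
  define A where "A = H_inner x y"
  have *: "2 * u * (cmod A)\<^sup>2 \<le> (H_norm x)\<^sup>2 + u\<^sup>2 * (cmod A)\<^sup>2 * (H_norm y)\<^sup>2" for u :: real
  proof -
    \<comment> \<open>The factor \<open>A\<close> makes both cross terms equal to the real number
      \<open>u * |A|^2\<close>, which leaves a quadratic in the real parameter
      \<open>u\<close>.\<close>
    define c where "c = of_real u * A"
    let ?z = "\<lambda>r. x r - c * y r"
    have cy: "(\<lambda>r. c * y r) \<in> H_space" "?z \<in> H_space"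
      using assms by (auto intro!: H_space_diff H_space_scale)
    have "H_inner ?z ?z = H_inner x x - cnj c * A - c * cnj A + c * cnj c * H_inner y y"
      using assms cy
      by (simp add: H_inner_diff_left H_inner_diff_right H_inner_scale_left H_inner_scale_right
          A_def H_inner_cnj[of y x] algebra_simps)
    then have "Re (H_inner ?z ?z) = (H_norm x)\<^sup>2 - 2 * u * (cmod A)\<^sup>2 + u\<^sup>2 * (cmod A)\<^sup>2 * (H_norm y)\<^sup>2"
      by (simp add: H_inner_self c_def cmod_power2) (simp add: algebra_simps power2_eq_square)
    moreover have "0 \<le> Re (H_inner ?z ?z)" by (simp add: H_inner_self del: of_real_power)
    ultimately show ?thesis by linarith
  qed
  show ?thesis
  proof (cases "A = 0")
    case False
    have "(cmod A)\<^sup>2 \<le> (H_norm x)\<^sup>2 * (H_norm y)\<^sup>2"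
    proof (cases "H_norm y = 0")
      case True
      \<comment> \<open>Without the quadratic term the inequality is linear in \<open>u\<close> and
        fails for large \<open>u\<close>.\<close>
      have "(cmod A)\<^sup>2 > 0" using False by simp
      then obtain u where "2 * u * (cmod A)\<^sup>2 > (H_norm x)\<^sup>2"
        by (intro that[of "(H_norm x)\<^sup>2 / (cmod A)\<^sup>2 + 1"]) (simp add: field_simps add_pos_nonneg)
      with *[of u] True show ?thesis by simp
    next
      case False
      then have p: "(H_norm y)\<^sup>2 > 0" by simp
      define n where "n = (H_norm y)\<^sup>2"
      \<comment> \<open>The choice \<open>u = 1 / n\<close> minimises the quadratic.\<close>
      have "2 * (1 / n) * (cmod A)\<^sup>2 \<le> (H_norm x)\<^sup>2 + (1 / n)\<^sup>2 * (cmod A)\<^sup>2 * n"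
        using *[of "1 / n"] by (simp add: n_def)
      moreover have "(1 / n)\<^sup>2 * (cmod A)\<^sup>2 * n = (1 / n) * (cmod A)\<^sup>2"
        using p by (simp add: n_def[symmetric] power2_eq_square)
      ultimately have "(cmod A)\<^sup>2 / n \<le> (H_norm x)\<^sup>2" by simp
      with p show ?thesis by (simp add: pos_divide_le_eq n_def)
    qed
    then show ?thesis
      by (metis A_def H_norm_nonneg mult_nonneg_nonneg power2_le_imp_le power_mult_distrib)
  qed (simp add: A_def[symmetric])
qed

lemma H_norm_triangle:
  assumes "x \<in> H_space" "y \<in> H_space"
  shows "H_norm (\<lambda>r. x r + y r) \<le> H_norm x + H_norm y"
proof (rule power2_le_imp_le)
  have "(H_norm (\<lambda>r. x r + y r))\<^sup>2 = Re (H_inner (\<lambda>r. x r + y r) (\<lambda>r. x r + y r))"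
    by (simp add: H_inner_self del: of_real_power)
  also have "\<dots> = (H_norm x)\<^sup>2 + (H_norm y)\<^sup>2 + Re (H_inner x y) + Re (H_inner y x)"
    using assms
    by (simp add: H_inner_add_left H_inner_add_right H_space_add H_inner_self[of x] H_inner_self[of y]
        del: of_real_power)
  also have "\<dots> \<le> (H_norm x + H_norm y)\<^sup>2"
    using H_Cauchy_Schwarz[OF assms] complex_Re_le_cmod[of "H_inner x y"] H_inner_cnj[of y x]
    by (simp add: power2_sum)
  finally show "(H_norm (\<lambda>r. x r + y r))\<^sup>2 \<le> (H_norm x + H_norm y)\<^sup>2" .
qed simp

lemma H_norm_diff_commute: "H_norm (\<lambda>r. x r - y r) = H_norm (\<lambda>r. y r - x r)"
  by (simp add: H_norm_eq norm_minus_commute)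

lemma H_norm_triangle_diff:
  assumes "x \<in> H_space" "y \<in> H_space"
  shows "\<bar>H_norm x - H_norm y\<bar> \<le> H_norm (\<lambda>r. x r - y r)"
proof -
  have "H_norm x \<le> H_norm (\<lambda>r. x r - y r) + H_norm y"
    using H_norm_triangle[of "\<lambda>r. x r - y r" y] assms by (simp add: H_space_diff)
  moreover have "H_norm y \<le> H_norm (\<lambda>r. y r - x r) + H_norm x"
    using H_norm_triangle[of "\<lambda>r. y r - x r" x] assms by (simp add: H_space_diff)
  ultimately show ?thesis using H_norm_diff_commute[of x y] by linarith
qed

text \<open>Expansion about the limits leaves three terms, each with a factor that tends to zero by
  Cauchy-Schwarz.\<close>

lemma tendsto_H_inner:
  assumes X: "\<forall>\<^sub>F h in F. X h \<in> H_space" "x \<in> H_space" "((\<lambda>h. H_norm (\<lambda>r. X h r - x r)) \<longlongrightarrow> 0) F"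
    and Y: "\<forall>\<^sub>F h in F. Y h \<in> H_space" "y \<in> H_space" "((\<lambda>h. H_norm (\<lambda>r. Y h r - y r)) \<longlongrightarrow> 0) F"
  shows "((\<lambda>h. H_inner (X h) (Y h)) \<longlongrightarrow> H_inner x y) F"
proof -
  let ?a = "\<lambda>h. H_norm (\<lambda>r. X h r - x r)" and ?b = "\<lambda>h. H_norm (\<lambda>r. Y h r - y r)"
  have "((\<lambda>h. H_inner (X h) (Y h) - H_inner x y) \<longlongrightarrow> 0) F"
  proof (rule tendsto_0_le)
    have "((\<lambda>h. ?a h * ?b h + ?a h * H_norm y + H_norm x * ?b h)
        \<longlongrightarrow> 0 * 0 + 0 * H_norm y + H_norm x * 0) F"
      by (intro tendsto_intros X Y)
    then show "((\<lambda>h. ?a h * ?b h + ?a h * H_norm y + H_norm x * ?b h) \<longlongrightarrow> 0) F" by simp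
    show "\<forall>\<^sub>F h in F. norm (H_inner (X h) (Y h) - H_inner x y)
        \<le> norm (?a h * ?b h + ?a h * H_norm y + H_norm x * ?b h) * 1"
      using X(1) Y(1)
    proof eventually_elim
      case (elim h)
      let ?d = "\<lambda>r. X h r - x r" and ?e = "\<lambda>r. Y h r - y r"
      have de: "?d \<in> H_space" "?e \<in> H_space" using elim X(2) Y(2) by (simp_all add: H_space_diff)
      have eq: "H_inner (X h) (Y h) - H_inner x y = H_inner ?d ?e + H_inner ?d y + H_inner x ?e"
        using elim X(2) Y(2) by (simp add: H_inner_diff_left H_inner_diff_right H_space_diff)
      have "norm (H_inner (X h) (Y h) - H_inner x y)
          \<le> norm (H_inner ?d ?e) + norm (H_inner ?d y) + norm (H_inner x ?e)"
        unfolding eq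
        using norm_triangle_ineq[of "H_inner ?d ?e + H_inner ?d y" "H_inner x ?e"]
          norm_triangle_ineq[of "H_inner ?d ?e" "H_inner ?d y"] by linarith
      then have "norm (H_inner (X h) (Y h) - H_inner x y)
          \<le> ?a h * ?b h + ?a h * H_norm y + H_norm x * ?b h"
        by (rule order_trans) (intro add_mono H_Cauchy_Schwarz de X(2) Y(2))
      then show ?case by simp
    qed
  qed
  then show ?thesis by (simp add: LIM_zero_cancel)
qed

section \<open>Strong time derivatives in \<open>H\<close>\<close>

definition H_deriv_at :: "(real \<Rightarrow> real \<Rightarrow> complex) \<Rightarrow> (real \<Rightarrow> complex) \<Rightarrow> real \<Rightarrow> bool"
  where "H_deriv_at x x' t \<longleftrightarrow>
    ((\<lambda>h. H_norm (\<lambda>r. (x (t + h) r - x t r) / of_real h - x' r)) \<longlongrightarrow> 0) (at 0)"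

text \<open>The difference quotient of the inner product is exactly
  \<open><Dx, y> + <x, Dy> + h <Dx, Dy>\<close>, with \<open>x\<close> and \<open>y\<close> frozen
  at time \<open>t\<close>; norm convergence of the quotients \<open>Dx\<close>, \<open>Dy\<close>
  then gives the product rule.\<close>

lemma Re_H_inner_has_derivative:
  assumes x: "\<forall>\<^sub>F s in nhds t. x s \<in> H_space" "x' \<in> H_space" "H_deriv_at x x' t"
    and y: "\<forall>\<^sub>F s in nhds t. y s \<in> H_space" "y' \<in> H_space" "H_deriv_at y y' t"
  shows "((\<lambda>s. Re (H_inner (x s) (y s))) has_real_derivative
    Re (H_inner x' (y t) + H_inner (x t) y')) (at t)"
proof -
  let ?D = "\<lambda>z h r. (z (t + h) r - z t r) / of_real h"
  have shift: "\<forall>\<^sub>F h in at 0. z (t + h) \<in> H_space" "z t \<in> H_space"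
    if "\<forall>\<^sub>F s in nhds t. z s \<in> H_space" for z :: "real \<Rightarrow> real \<Rightarrow> complex"
  proof -
    have "filterlim (\<lambda>h. t + h) (nhds t) (at 0)"
      using tendsto_add[OF tendsto_const[of t] tendsto_ident_at[of 0 UNIV]] by simp
    then show "\<forall>\<^sub>F h in at 0. z (t + h) \<in> H_space"
      using that unfolding filterlim_iff by blast
    show "z t \<in> H_space" using that by (rule eventually_nhds_x_imp_x)
  qed
  note sx = shift[OF x(1)] and sy = shift[OF y(1)]
  have D: "?D z h \<in> H_space" if "z (t + h) \<in> H_space" "z t \<in> H_space"
    for z :: "real \<Rightarrow> real \<Rightarrow> complex" and h
    using H_space_scale[OF H_space_diff[OF that], of "1 / of_real h"] by simp
  have Dx: "\<forall>\<^sub>F h in at 0. ?D x h \<in> H_space"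
    using sx(1) by (rule eventually_mono) (use D sx(2) in blast)
  have Dy: "\<forall>\<^sub>F h in at 0. ?D y h \<in> H_space"
    using sy(1) by (rule eventually_mono) (use D sy(2) in blast)
  have z: "((\<lambda>h. H_norm (\<lambda>r. u r - u r)) \<longlongrightarrow> 0) (at (0::real))" for u
    by (simp add: H_norm_eq)
  have lim: "((\<lambda>h. H_inner (?D x h) (y t) + H_inner (x t) (?D y h)
        + of_real h * H_inner (?D x h) (?D y h))
      \<longlongrightarrow> H_inner x' (y t) + H_inner (x t) y' + of_real 0 * H_inner x' y') (at 0)"
    by (intro tendsto_add tendsto_mult tendsto_H_inner tendsto_of_real tendsto_ident_at Dx Dy z
        x(2) y(2) sx(2) sy(2) always_eventually allI x(3)[unfolded H_deriv_at_def] y(3)[unfolded H_deriv_at_def])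
  have eq: "\<forall>\<^sub>F h in at 0. H_inner (?D x h) (y t) + H_inner (x t) (?D y h)
        + of_real h * H_inner (?D x h) (?D y h)
      = (H_inner (x (t + h)) (y (t + h)) - H_inner (x t) (y t)) /\<^sub>R h"
    using sx(1) sy(1) eventually_neq_at_within[of 0 0 UNIV]
  proof eventually_elim
    case (elim h)
    have Dz: "?D x h = (\<lambda>r. inverse (of_real h) * (x (t + h) r - x t r))"
        "?D y h = (\<lambda>r. inverse (of_real h) * (y (t + h) r - y t r))"
      by (auto simp: field_simps)
    \<comment> \<open>Here \<open>i\<close> stands for \<open>1 / h\<close>, and \<open>A\<close>,
      \<open>B\<close>, \<open>C\<close>, \<open>E\<close> for the inner products of
      \<open>x\<close> and \<open>y\<close> at the times \<open>(t + h, t)\<close>,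
      \<open>(t, t)\<close>, \<open>(t, t + h)\<close> and \<open>(t + h, t + h)\<close>.\<close>
    have *: "i * (A - B) + i * (C - B) + c * (i * (i * (E - C - (A - B)))) = i * (E - B)"
      if "c * i = 1" for A B C E c i :: complex
    proof -
      have "c * (i * (i * (E - C - (A - B)))) = (c * i) * (i * (E - C - (A - B)))"
        by (simp only: mult.assoc)
      then show ?thesis by (simp add: that algebra_simps)
    qed
    have "complex_of_real h * inverse (of_real h) = 1" using elim by simp
    note * = *[OF this]
    have d: "H_inner (\<lambda>r. x (t + h) r - x t r) (y t) = H_inner (x (t + h)) (y t) - H_inner (x t) (y t)"
      "H_inner (x t) (\<lambda>r. y (t + h) r - y t r) = H_inner (x t) (y (t + h)) - H_inner (x t) (y t)"
      "H_inner (\<lambda>r. x (t + h) r - x t r) (\<lambda>r. y (t + h) r - y t r) =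
        H_inner (x (t + h)) (y (t + h)) - H_inner (x t) (y (t + h))
        - (H_inner (x (t + h)) (y t) - H_inner (x t) (y t))"
      using elim sx(2) sy(2) by (simp_all add: H_inner_diff_left H_inner_diff_right H_space_diff)
    show ?case
      unfolding Dz H_inner_scale_left H_inner_scale_right d
      by (simp only: complex_cnj_inverse complex_cnj_complex_of_real * scaleR_conv_of_real of_real_inverse)
  qed
  show ?thesis
    using tendsto_Re[OF Lim_transform_eventually[OF lim eq]]
    by (simp add: DERIV_def divide_inverse mult.commute)

qed

section \<open>Local absolute continuity and integration by parts\<close>

text \<open>Needed for Fubini. Completion preserves the measure of Borel sets, so a countable cover
  for \<open>lborel\<close> serves again.\<close>

lemma sigma_finite_lebesgue: "sigma_finite_measure (lebesgue :: 'a::euclidean_space measure)"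
proof
  from lborel.sigma_finite_countable obtain A :: "'a set set"
    where A: "countable A" "A \<subseteq> sets lborel" "\<Union>A = space lborel" "\<forall>a\<in>A. emeasure lborel a \<noteq> \<infinity>"
    by blast
  have "countable A \<and> A \<subseteq> sets lebesgue \<and> \<Union>A = space lebesgue
      \<and> (\<forall>a\<in>A. emeasure lebesgue a \<noteq> \<infinity>)"
    using A by (auto simp: subset_iff)
  then show "\<exists>A::'a set set. countable A \<and> A \<subseteq> sets lebesgue \<and> \<Union>A = space lebesgue
      \<and> (\<forall>a\<in>A. emeasure lebesgue a \<noteq> \<infinity>)"
    by (rule exI)
qed

text \<open>Only the integral relation between \<open>u\<close>, \<open>v\<close> and
  \<open>u'\<close>, \<open>v'\<close> is assumed, with no pointwise derivatives, so that second
  derivatives of domain elements, which are merely integrable on compact intervals, are covered. The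
  proof is Fubini on a triangle.\<close>

lemma set_lebesgue_integral_by_parts:
  fixes u u' v v' :: "real \<Rightarrow> complex"
  assumes ab: "a \<le> b"
    and u': "set_integrable lebesgue {a..b} u'" and v': "set_integrable lebesgue {a..b} v'"
    and u: "\<And>x y. a \<le> x \<Longrightarrow> x \<le> y \<Longrightarrow> y \<le> b \<Longrightarrow> (LINT r:{x..y}|lebesgue. u' r) = u y - u x"
    and v: "\<And>x y. a \<le> x \<Longrightarrow> x \<le> y \<Longrightarrow> y \<le> b \<Longrightarrow> (LINT r:{x..y}|lebesgue. v' r) = v y - v x"
    and u'v: "set_integrable lebesgue {a..b} (\<lambda>r. u' r * v r)"
    and uv': "set_integrable lebesgue {a..b} (\<lambda>r. u r * v' r)"
  shows "(LINT r:{a..b}|lebesgue. u' r * v r + u r * v' r) = u b * v b - u a * v a"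
proof -
  define U where "U = (\<lambda>x. indicator {a..b} x *\<^sub>R u' x)"
  define V where "V = (\<lambda>y. indicator {a..b} y *\<^sub>R v' y)"
  have U: "integrable lebesgue U" and V: "integrable lebesgue V"
    using u' v' by (simp_all add: set_integrable_def U_def V_def)
  then have [measurable]: "U \<in> borel_measurable lebesgue" "V \<in> borel_measurable lebesgue" by auto
  have [measurable]: "(\<lambda>x::real. x) \<in> borel_measurable lebesgue" by (simp add: measurable_completion)
  \<comment> \<open>The product \<open>u'(x) v'(y)\<close> on the part \<open>y \<le> x\<close> of
    the square over \<open>{a..b}\<close>. Integrating first in \<open>y\<close> produces
    \<open>v x - v a\<close>, first in \<open>x\<close> produces \<open>u b - u y\<close>.\<close>
  define f where "f = (\<lambda>x y. indicator {p. snd p \<le> fst p} (x, y) *\<^sub>R (U x * V y))"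
  interpret sigma_finite_measure "lebesgue :: real measure"
    by (rule sigma_finite_lebesgue)
  interpret P: pair_sigma_finite "lebesgue :: real measure" "lebesgue :: real measure" ..
  have UV: "integrable (lebesgue \<Otimes>\<^sub>M lebesgue) (\<lambda>(x, y). U x * V y)"
  proof (rule P.Fubini_integrable)
    show "(\<lambda>(x, y). U x * V y) \<in> borel_measurable (lebesgue \<Otimes>\<^sub>M lebesgue)" by measurable
    show "integrable lebesgue (\<lambda>x. LINT y|lebesgue. norm (case (x, y) of (x, y) \<Rightarrow> U x * V y))"
      using U by (simp add: norm_mult)
    show "AE x in lebesgue. integrable lebesgue (\<lambda>y. case (x, y) of (x, y) \<Rightarrow> U x * V y)"
      using V by (intro AE_I2) simp
  qed
  have "{p. snd p \<le> fst p} = {p \<in> space (lebesgue \<Otimes>\<^sub>M lebesgue). (snd p :: real) \<le> fst p}"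
    by (auto simp: space_pair_measure)
  also have "\<dots> \<in> sets (lebesgue \<Otimes>\<^sub>M lebesgue)" by measurable
  finally have S: "{p. (snd p :: real) \<le> fst p} \<in> sets (lebesgue \<Otimes>\<^sub>M lebesgue)" .
  have f: "integrable (lebesgue \<Otimes>\<^sub>M lebesgue) (case_prod f)"
    using integrable_mult_indicator[OF S UV] by (simp add: f_def case_prod_beta')
  have inner_y: "(LINT y|lebesgue. f x y) = indicator {a..b} x *\<^sub>R (u' x * v x) - v a * U x" for x
  proof (cases "x \<in> {a..b}")
    case True
    have "(LINT y|lebesgue. f x y) = (LINT y|lebesgue. U x * (indicator {a..x} y *\<^sub>R v' y))"
      using True by (intro Bochner_Integration.integral_cong) (auto simp: f_def V_def indicator_def)
    then have "(LINT y|lebesgue. f x y) = U x * (LINT y:{a..x}|lebesgue. v' y)"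
      by (simp only: integral_mult_right_zero set_lebesgue_integral_def)
    then have "(LINT y|lebesgue. f x y) = U x * (v x - v a)"
      using True v[of a x] by simp
    then show ?thesis using True by (simp add: U_def algebra_simps)
  next
    case False
    then show ?thesis by (simp add: f_def U_def)
  qed
  have inner_x: "(LINT x|lebesgue. f x y) = u b * V y - indicator {a..b} y *\<^sub>R (u y * v' y)" for y
  proof (cases "y \<in> {a..b}")
    case True
    have "(LINT x|lebesgue. f x y) = (LINT x|lebesgue. (indicator {y..b} x *\<^sub>R u' x) * V y)"
      using True by (intro Bochner_Integration.integral_cong) (auto simp: f_def U_def indicator_def)
    then have "(LINT x|lebesgue. f x y) = (LINT x:{y..b}|lebesgue. u' x) * V y"
      by (simp only: integral_mult_left_zero set_lebesgue_integral_def)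
    then have "(LINT x|lebesgue. f x y) = (u b - u y) * V y"
      using True u[of y b] by simp
    then show ?thesis using True by (simp add: V_def algebra_simps)
  next
    case False
    then show ?thesis by (simp add: f_def V_def)
  qed
  have IU: "integral\<^sup>L lebesgue U = u b - u a" and IV: "integral\<^sup>L lebesgue V = v b - v a"
    using u[of a b] v[of a b] ab by (simp_all add: U_def V_def set_lebesgue_integral_def)
  have "(LINT y|lebesgue. (LINT x|lebesgue. f x y)) = (LINT x|lebesgue. (LINT y|lebesgue. f x y))"
    using f by (rule P.Fubini_integral)
  then have "u b * (v b - v a) - (LINT r:{a..b}|lebesgue. u r * v' r)
      = (LINT r:{a..b}|lebesgue. u' r * v r) - v a * (u b - u a)"
    unfolding inner_x inner_y using U V u'v uv'
    by (simp add: IU IV set_lebesgue_integral_def set_integrable_def)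
  moreover have "(LINT r:{a..b}|lebesgue. u' r * v r + u r * v' r)
      = (LINT r:{a..b}|lebesgue. u' r * v r) + (LINT r:{a..b}|lebesgue. u r * v' r)"
    using u'v uv' by (rule set_integral_add)
  ultimately show ?thesis by (simp add: algebra_simps)
qed

lemma set_integral_FTC:
  fixes g :: "real \<Rightarrow> complex"
  assumes "a \<le> b" "\<And>r. r \<in> {a..b} \<Longrightarrow> (g has_vector_derivative g' r) (at r)" "continuous_on {a..b} g'"
  shows "set_integrable lebesgue {a..b} g'" "(LINT r:{a..b}|lebesgue. g' r) = g b - g a"
proof -
  show 1: "set_integrable lebesgue {a..b} g'"
    using assms(3) by (rule absolutely_integrable_continuous_real)
  have "(g' has_integral (g b - g a)) {a..b}"
    by (rule fundamental_theorem_of_calculus[OF assms(1) has_vector_derivative_at_within[OF assms(2)]])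
  then show "(LINT r:{a..b}|lebesgue. g' r) = g b - g a"
    unfolding set_lebesgue_integral_eq_integral(2)[OF 1] by (rule integral_unique)
qed

section \<open>From local absolute continuity to continuous differentiability and back\<close>

lemma C1_locally_ac:
  assumes g: "\<And>r. r \<in> {0<..<1} \<Longrightarrow> (g has_vector_derivative g' r) (at r)"
    and c: "continuous_on {0<..<1} g'"
  shows "locally_ac g" and "\<And>r. r \<in> {0<..<1} \<Longrightarrow> rderiv g r = g' r"
proof -
  show 1: "rderiv g r = g' r" if "r \<in> {0<..<1}" for r
    using g[OF that] by (simp add: rderiv_def vector_derivative_at)
  show "locally_ac g"
    unfolding locally_ac_def
  proof (intro allI impI)
    fix a b :: real assume ab: "0 < a \<and> a \<le> b \<and> b < 1"
    then have sub: "{a..b} \<subseteq> {0<..<1}" by auto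
    have "continuous_on {0<..<1} (rderiv g)"
      using c 1 by (simp cong: continuous_on_cong_simp)
    with sub have "continuous_on {a..b} (rderiv g)" by (rule continuous_on_subset[rotated])
    then show "set_integrable lebesgue {a..b} (rderiv g) \<and> (LINT r:{a..b}|lebesgue. rderiv g r) = g b - g a"
      using set_integral_FTC[of a b g "rderiv g"] g 1 sub ab by (metis subsetD)
  qed
qed

lemma locally_ac_integral:
  assumes "locally_ac \<psi>" "0 < a" "a \<le> x" "x < 1"
  shows "\<psi> x = \<psi> a + integral {a..x} (rderiv \<psi>)" "rderiv \<psi> absolutely_integrable_on {a..x}"
proof -
  have *: "set_integrable lebesgue {a..x} (rderiv \<psi>)" "(LINT r:{a..x}|lebesgue. rderiv \<psi> r) = \<psi> x - \<psi> a"
    using assms unfolding locally_ac_def by auto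
  show "rderiv \<psi> absolutely_integrable_on {a..x}" by (rule *(1))
  show "\<psi> x = \<psi> a + integral {a..x} (rderiv \<psi>)"
    using *(2) unfolding set_lebesgue_integral_eq_integral(2)[OF *(1)] by (simp only: algebra_simps)
qed

lemma locally_ac_imp_continuous_on:
  assumes "locally_ac \<psi>"
  shows "continuous_on {0<..<1} \<psi>"
proof (rule continuous_at_imp_continuous_on, rule ballI)
  fix r :: real assume r: "r \<in> {0<..<1}"
  \<comment> \<open>A compact neighbourhood of \<open>r\<close> inside the open interval, where the
    integral representation is available.\<close>
  define a b where "a = r / 2" and "b = (r + 1) / 2"
  have ab: "0 < a" "a < r" "r < b" "b < 1" using r by (auto simp: a_def b_def)
  have "continuous_on {a..b} (\<lambda>x. \<psi> a + integral {a..x} (rderiv \<psi>))"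
    using locally_ac_integral(2)[OF assms, of a b] ab
    by (intro continuous_intros indefinite_integral_continuous_1)
       (auto simp: absolutely_integrable_on_def)
  then have "continuous_on {a..b} \<psi>"
    by (rule continuous_on_eq, intro locally_ac_integral(1)[OF assms, symmetric]) (use ab in auto)
  then show "isCont \<psi> r"
    using ab by (intro continuous_on_interior) auto
qed

text \<open>Local absolute continuity controls \<open>rderiv \<phi>\<close> only almost everywhere,
  and its value is unspecified where \<open>\<phi>\<close> is not differentiable. When it is
  continuous, its indefinite integral is differentiable at every point, and \<open>\<phi>\<close> is
  such an integral up to a constant.\<close>

lemma locally_ac_C1:
  assumes "locally_ac \<phi>" "continuous_on {0<..<1} (rderiv \<phi>)" "r \<in> {0<..<1}"
  shows "(\<phi> has_vector_derivative rderiv \<phi> r) (at r)"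
proof -
  define a b where "a = r / 2" and "b = (r + 1) / 2"
  have ab: "0 < a" "a < r" "r < b" "b < 1" using assms(3) by (auto simp: a_def b_def)
  have "continuous_on {a..b} (rderiv \<phi>)"
    using assms(2) by (rule continuous_on_subset) (use ab in auto)
  then have "((\<lambda>x. integral {a..x} (rderiv \<phi>)) has_vector_derivative rderiv \<phi> r) (at r within {a..b})"
    by (rule integral_has_vector_derivative) (use ab in auto)
  then have "((\<lambda>x. \<phi> a + integral {a..x} (rderiv \<phi>)) has_vector_derivative (0 + rderiv \<phi> r)) (at r within {a..b})"
    by (intro has_vector_derivative_add has_vector_derivative_const)
  then have "((\<lambda>x. \<phi> a + integral {a..x} (rderiv \<phi>)) has_vector_derivative rderiv \<phi> r) (at r)"
    using ab by (simp add: at_within_Icc_at)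
  then show ?thesis
    by (rule has_vector_derivative_transform_within_open[where S = "{a<..<b}"],
        use ab in auto, intro locally_ac_integral(1)[OF assms(1), symmetric]) (use ab in auto)
qed

lemma neumann_domain_C1:
  assumes "\<phi> \<in> neumann_domain k"
  shows "continuous_on {0<..<1} (rderiv \<phi>)" "continuous_on {0<..<1} \<phi>"
    "\<And>r. r \<in> {0<..<1} \<Longrightarrow> (\<phi> has_vector_derivative rderiv \<phi> r) (at r)"
  using assms locally_ac_imp_continuous_on locally_ac_C1
  by (auto simp: neumann_domain_def H1_space_def)

text \<open>Since \<open>1 / r\<close> is not integrable at \<open>0\<close>, the function \<open>r h(r)\<close> takes small values near \<open>0\<close>.\<close>

lemma integrable_leb01_small:
  fixes h :: "real \<Rightarrow> real"
  assumes h: "integrable leb01 h" and nn: "\<And>r. 0 < r \<Longrightarrow> r < 1 \<Longrightarrow> 0 \<le> h r"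
    and "0 < \<epsilon>" "0 < \<rho>" "\<rho> < 1"
  shows "\<exists>r. 0 < r \<and> r < \<rho> \<and> r * h r < \<epsilon>"
proof (rule ccontr)
  assume "\<not> ?thesis"
  then have ge: "\<epsilon> \<le> r * h r" if "0 < r" "r < \<rho>" for r using that by force
  define C where "C = integral\<^sup>L leb01 h"
  have C0: "0 \<le> C" unfolding C_def by (rule integral_nonneg_AE) (auto intro!: AE_I2 nn)
  define y where "y = \<rho> / 2"
  \<comment> \<open>Chosen so that the integral of \<open>\<epsilon> / r\<close> from
    \<open>x\<close> to \<open>y\<close> is \<open>C + 1\<close>, which exceeds the integral of
    \<open>h\<close>.\<close>
  define x where "x = y * exp (- (C + 1) / \<epsilon>)"
  have y: "0 < y" "y < \<rho>" "y < 1" using assms by (auto simp: y_def)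
  have x: "0 < x" "x \<le> y" using y C0 \<open>0 < \<epsilon>\<close> by (auto simp: x_def mult_le_cancel_left1 divide_le_0_iff)
  have d: "((\<lambda>r. \<epsilon> * ln r) has_vector_derivative \<epsilon> / r) (at r)" if "r \<in> {x..y}" for r
    using that x by (auto simp: has_real_derivative_iff_has_vector_derivative[symmetric]
        intro!: derivative_eq_intros)
  have c: "continuous_on {x..y} (\<lambda>r. \<epsilon> / r)" using x by (intro continuous_intros) auto
  have I: "set_integrable lebesgue {x..y} (\<lambda>r. \<epsilon> / r)"
    using c by (rule absolutely_integrable_continuous_real)
  have "((\<lambda>r. \<epsilon> / r) has_integral (\<epsilon> * ln y - \<epsilon> * ln x)) {x..y}"
    by (rule fundamental_theorem_of_calculus[OF x(2) has_vector_derivative_at_within[OF d]])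
  then have e: "(LINT r:{x..y}|lebesgue. \<epsilon> / r) = \<epsilon> * ln y - \<epsilon> * ln x"
    unfolding set_lebesgue_integral_eq_integral(2)[OF I] by (rule integral_unique)
  have h1: "set_integrable lebesgue {0<..<1} h"
    using h by (simp add: integrable_restrict_space set_integrable_def)
  have "(LINT r:{x..y}|lebesgue. \<epsilon> / r) \<le> (LINT r:{0<..<1}|lebesgue. h r)"
    unfolding set_lebesgue_integral_def
  proof (rule integral_mono)
    show "integrable lebesgue (\<lambda>r. indicator {x..y} r *\<^sub>R (\<epsilon> / r))" using I by (simp add: set_integrable_def)
    show "integrable lebesgue (\<lambda>r. indicator {0<..<1} r *\<^sub>R h r)" using h1 by (simp add: set_integrable_def)
    fix r :: real
    show "indicator {x..y} r *\<^sub>R (\<epsilon> / r) \<le> indicator {0<..<1} r *\<^sub>R h r"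
    proof (cases "r \<in> {x..y}")
      case True
      then have "\<epsilon> / r \<le> h r" using ge[of r] x y by (simp add: pos_divide_le_eq mult.commute)
      then show ?thesis using True x y by auto
    next
      case False then show ?thesis using nn[of r] by (auto simp: indicator_def)
    qed
  qed
  then have "\<epsilon> * ln y - \<epsilon> * ln x \<le> C"
    unfolding e by (simp add: C_def integral_restrict_space set_lebesgue_integral_def)
  moreover have "ln x = ln y + (- (C + 1) / \<epsilon>)"
    using y by (simp add: x_def ln_mult)
  ultimately show False using \<open>0 < \<epsilon>\<close> by (simp add: field_simps)
qed


section \<open>The \<open>H^1\<close> pairing and Green's identity for the Neumann Laplacian\<close>

definition H1_pair :: "int \<Rightarrow> (real \<Rightarrow> complex) \<Rightarrow> (real \<Rightarrow> complex) \<Rightarrow> real \<Rightarrow> complex"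
  where "H1_pair k \<phi> \<eta> r = (rderiv \<phi> r * cnj (rderiv \<eta> r)
    + of_real ((of_int k)\<^sup>2 / r\<^sup>2) * \<phi> r * cnj (\<eta> r)) * of_real r"

text \<open>The class to which both the domain elements and their inviscid transports belong. In it
  \<open>rderiv\<close> is a true derivative at every interior point, which gives measurability and
  the pointwise product rule.\<close>

definition C1_01 :: "(real \<Rightarrow> complex) \<Rightarrow> bool"
  where "C1_01 \<eta> \<longleftrightarrow> continuous_on {0<..<1} (rderiv \<eta>) \<and>
    (\<forall>r\<in>{0<..<1}. (\<eta> has_vector_derivative rderiv \<eta> r) (at r))"

lemma C1_01_continuous_on: "C1_01 \<eta> \<Longrightarrow> continuous_on {0<..<1} \<eta>"
  unfolding C1_01_def
  by (meson continuous_at_imp_continuous_on has_vector_derivative_continuous)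

lemma C1_01_measurable:
  assumes "C1_01 \<eta>"
  shows "\<eta> \<in> borel_measurable leb01" "rderiv \<eta> \<in> borel_measurable leb01"
  using assms C1_01_continuous_on[OF assms]
  by (auto simp: C1_01_def intro: borel_measurable_leb01_continuous)

lemma neumann_domain_C1_01: "\<phi> \<in> neumann_domain k \<Longrightarrow> C1_01 \<phi>"
  using neumann_domain_C1 by (auto simp: C1_01_def)

lemma H1_density_nonneg: "0 < r \<Longrightarrow> 0 \<le> H1_density k \<phi> r"
  by (simp add: H1_density_def)

lemma cmod_mult_le: "cmod x * cmod y \<le> (cmod x)\<^sup>2 / 2 + (cmod y)\<^sup>2 / 2"
  using sum_squares_bound[of "cmod x" "cmod y"] by (simp add: algebra_simps)

lemma cmod_H1_pair_le:
  assumes "0 < r"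
  shows "cmod (H1_pair k \<phi> \<eta> r) \<le> H1_density k \<phi> r + H1_density k \<eta> r"
proof -
  define c where "c = (of_int k)\<^sup>2 / r\<^sup>2"
  have c: "0 \<le> c" by (simp add: c_def)
  have "cmod (rderiv \<phi> r * cnj (rderiv \<eta> r) + of_real c * \<phi> r * cnj (\<eta> r))
      \<le> cmod (rderiv \<phi> r) * cmod (rderiv \<eta> r) + c * (cmod (\<phi> r) * cmod (\<eta> r))"
    using c by (intro order_trans[OF norm_triangle_ineq]) (simp add: norm_mult)
  moreover have "cmod (rderiv \<phi> r) * cmod (rderiv \<eta> r) \<le> (cmod (rderiv \<phi> r))\<^sup>2 + (cmod (rderiv \<eta> r))\<^sup>2"
    using cmod_mult_le[of "rderiv \<phi> r" "rderiv \<eta> r"] zero_le_power2[of "cmod (rderiv \<phi> r)"]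
      zero_le_power2[of "cmod (rderiv \<eta> r)"] by linarith
  moreover have "c * (cmod (\<phi> r) * cmod (\<eta> r)) \<le> c * ((cmod (\<phi> r))\<^sup>2 + (cmod (\<eta> r))\<^sup>2)"
    using cmod_mult_le[of "\<phi> r" "\<eta> r"] zero_le_power2[of "cmod (\<phi> r)"]
      zero_le_power2[of "cmod (\<eta> r)"] c by (intro mult_left_mono) linarith+
  ultimately have le: "cmod (rderiv \<phi> r * cnj (rderiv \<eta> r) + of_real c * \<phi> r * cnj (\<eta> r))
      \<le> ((cmod (rderiv \<phi> r))\<^sup>2 + c * (cmod (\<phi> r))\<^sup>2) + ((cmod (rderiv \<eta> r))\<^sup>2 + c * (cmod (\<eta> r))\<^sup>2)"
    (is "cmod ?X \<le> ?A + ?B") by (simp add: distrib_left)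
  have "cmod (?X * of_real r) = cmod ?X * r" using assms by (simp only: norm_mult norm_of_real abs_of_pos)
  also have "\<dots> \<le> (?A + ?B) * r" using le assms by (intro mult_right_mono) auto
  also have "\<dots> = ?A * r + ?B * r" by (rule distrib_right)
  finally show ?thesis unfolding H1_pair_def H1_density_def c_def .
qed

lemma H1_pair_integrable:
  assumes "\<phi> \<in> H1_space k" "C1_01 \<phi>" "\<eta> \<in> H1_space k" "C1_01 \<eta>"
  shows "integrable leb01 (H1_pair k \<phi> \<eta>)"
proof (rule Bochner_Integration.integrable_bound)
  show "integrable leb01 (\<lambda>r. H1_density k \<phi> r + H1_density k \<eta> r)"
    using assms by (auto simp: H1_space_iff)
  note [measurable] = C1_01_measurable[OF assms(2)] C1_01_measurable[OF assms(4)]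
  have 1: "(\<lambda>r. of_real ((of_int k)\<^sup>2 / r\<^sup>2) :: complex) \<in> borel_measurable leb01"
    by (intro borel_measurable_leb01_continuous continuous_intros) auto
  show "H1_pair k \<phi> \<eta> \<in> borel_measurable leb01"
    unfolding H1_pair_def[abs_def] by (intro borel_measurable_times borel_measurable_add 1) measurable
  show "AE r in leb01. norm (H1_pair k \<phi> \<eta> r) \<le> norm (H1_density k \<phi> r + H1_density k \<eta> r)"
    using AE_leb01
  proof eventually_elim
    case (elim r)
    then show ?case
      using cmod_H1_pair_le[of r k \<phi> \<eta>] H1_density_nonneg[of r k \<phi>] H1_density_nonneg[of r k \<eta>] by simp
  qed
qed

text \<open>Controls the boundary term at \<open>r = 1\<close> in Green's identity. Away from zero
  the weight is harmless: for \<open>r \<ge> 1 / 2\<close> the derivative is bounded by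
  \<open>1 + 2 * H1_density\<close>, which is integrable.\<close>

lemma C1_01_bounded_near_1:
  assumes "\<eta> \<in> H1_space k" "C1_01 \<eta>"
  obtains C where "0 \<le> C" "\<And>r. 1 / 2 \<le> r \<Longrightarrow> r < 1 \<Longrightarrow> cmod (\<eta> r) \<le> C"
proof -
  define D where "D = (\<integral>r. 1 + 2 * H1_density k \<eta> r \<partial>leb01)"
  have one: "integrable leb01 (\<lambda>r. 1::real)"
    by (simp add: integrable_restrict_space)
  have I: "integrable leb01 (\<lambda>r. 1 + 2 * H1_density k \<eta> r)"
    using assms(1) one by (simp add: H1_space_iff)
  have "cmod (\<eta> r) \<le> cmod (\<eta> (1/2)) + D" if r: "1 / 2 \<le> r" "r < 1" for r
  proof -
    have "locally_ac \<eta>" using assms by (simp add: H1_space_iff)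
    then have *: "set_integrable lebesgue {1/2..r} (rderiv \<eta>)"
        "(LINT x:{1/2..r}|lebesgue. rderiv \<eta> x) = \<eta> r - \<eta> (1/2)"
      using r by (auto simp: locally_ac_def)
    have "cmod (\<eta> r - \<eta> (1/2)) \<le> (LINT x|lebesgue. norm (indicator {1/2..r} x *\<^sub>R rderiv \<eta> x))"
      unfolding *(2)[symmetric] set_lebesgue_integral_def by (rule integral_norm_bound)
    also have "\<dots> \<le> (LINT x|lebesgue. indicator {0<..<1} x *\<^sub>R (1 + 2 * H1_density k \<eta> x))"
    proof (rule integral_mono)
      show "integrable lebesgue (\<lambda>x. norm (indicator {1/2..r} x *\<^sub>R rderiv \<eta> x))"
        using *(1) unfolding set_integrable_def by (rule integrable_norm)
      show "integrable lebesgue (\<lambda>x. indicator {0<..<1} x *\<^sub>R (1 + 2 * H1_density k \<eta> x))"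
        using I by (simp add: integrable_restrict_space)
      fix x :: real
      show "norm (indicator {1/2..r} x *\<^sub>R rderiv \<eta> x) \<le> indicator {0<..<1} x *\<^sub>R (1 + 2 * H1_density k \<eta> x)"
      proof (cases "x \<in> {1/2..r}")
        case True
        define d where "d = cmod (rderiv \<eta> x)"
        have "2 * d \<le> d\<^sup>2 + 1" using sum_squares_bound[of d 1] by simp
        moreover have "0 \<le> d" by (simp add: d_def)
        ultimately have "d \<le> 1 + d\<^sup>2" by linarith
        moreover have "d\<^sup>2 * 1 \<le> d\<^sup>2 * (2 * x)" using True by (intro mult_left_mono) auto
        moreover have "d\<^sup>2 * x \<le> H1_density k \<eta> x"
          using True unfolding H1_density_def d_def by (intro mult_right_mono) auto
        ultimately have "d \<le> 1 + 2 * H1_density k \<eta> x" by linarith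
        then show ?thesis using True r by (simp add: d_def)
      next
        case False
        then show ?thesis using H1_density_nonneg[of x k \<eta>] by (auto simp: indicator_def)
      qed
    qed
    also have "\<dots> = D" by (simp add: D_def integral_restrict_space)
    finally show ?thesis using norm_triangle_sub[of "\<eta> r" "\<eta> (1/2)"] by linarith
  qed
  moreover have "0 \<le> D" unfolding D_def
    by (rule integral_nonneg_AE) (auto intro!: AE_I2 add_nonneg_nonneg H1_density_nonneg)
  ultimately show thesis by (intro that[of "cmod (\<eta> (1/2)) + D"]) auto
qed


text \<open>Integration by parts on compact intervals leaves the boundary term \<open>w\<close>. It
  vanishes at \<open>1\<close> by the Neumann condition; at \<open>0\<close> no boundary condition
  is imposed, but finiteness of the \<open>H^1\<close> norms makes \<open>w\<close> small along a
  sequence, which suffices.\<close>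

lemma laplace_inner:
  assumes \<phi>: "\<phi> \<in> neumann_domain k" "\<phi> \<in> H_space"
    and \<eta>: "\<eta> \<in> H1_space k" "C1_01 \<eta>" "\<eta> \<in> H_space"
    and k: "k \<noteq> 0"
  shows "H_inner (laplace_k k \<phi>) \<eta> = - integral\<^sup>L leb01 (H1_pair k \<phi> \<eta>)"
proof -
  define w where "w r = rderiv \<phi> r * (of_real r * cnj (\<eta> r))" for r
  \<comment> \<open>The zeroth-order terms cancel in \<open>Q\<close>, which is what the product
    rule predicts for the derivative of \<open>w\<close>.\<close>
  define Q where "Q r = laplace_k k \<phi> r * cnj (\<eta> r) * of_real r + H1_pair k \<phi> \<eta> r" for r
  have \<phi>1: "\<phi> \<in> H1_space k" "locally_ac (rderiv \<phi>)" "laplace_k k \<phi> \<in> H_space"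
      "(rderiv \<phi> \<longlongrightarrow> 0) (at_left 1)" "C1_01 \<phi>"
    using \<phi>(1) neumann_domain_C1_01 by (auto simp: neumann_domain_def)
  have iL: "integrable leb01 (\<lambda>r. laplace_k k \<phi> r * cnj (\<eta> r) * of_real r)"
    using \<phi>1(3) \<eta>(3) by (rule H_inner_integrable)
  have iP: "integrable leb01 (H1_pair k \<phi> \<eta>)"
    using \<phi>1(1,5) \<eta>(1,2) by (rule H1_pair_integrable)
  have iQ: "integrable leb01 Q"
    unfolding Q_def[abs_def] using iL iP by (rule Bochner_Integration.integrable_add)
  then have iQ': "set_integrable lebesgue {0<..<1} Q"
    by (simp add: integrable_restrict_space set_integrable_def)
  have \<eta>': "(\<eta> has_vector_derivative rderiv \<eta> r) (at r)" if "r \<in> {0<..<1}" for r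
    using \<eta>(2) that by (auto simp: C1_01_def)
  have c\<eta>: "continuous_on {0<..<1} \<eta>" "continuous_on {0<..<1} (rderiv \<eta>)"
    using \<eta>(2) C1_01_continuous_on by (auto simp: C1_01_def)
  have c\<phi>: "continuous_on {0<..<1} (rderiv \<phi>)"
    using \<phi>1(5) by (simp add: C1_01_def)
  have Q_ab: "(LINT r:{a..b}|lebesgue. Q r) = w b - w a" if ab: "0 < a" "a \<le> b" "b < 1" for a b
  proof -
    define v where "v r = of_real r * cnj (\<eta> r)" for r :: real
    define v' where "v' r = cnj (\<eta> r) + of_real r * cnj (rderiv \<eta> r)" for r :: real
    have sub: "{a..b} \<subseteq> {0<..<1}" using ab by auto
    have cv: "continuous_on {a..b} v" "continuous_on {a..b} v'" "continuous_on {a..b} (rderiv \<phi>)"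
      unfolding v_def[abs_def] v'_def[abs_def]
      by (intro continuous_intros continuous_on_subset[OF c\<eta>(1) sub] continuous_on_subset[OF c\<eta>(2) sub]
          continuous_on_subset[OF c\<phi> sub])+
    have dv: "(v has_vector_derivative v' r) (at r)" if "r \<in> {a..b}" for r
    proof -
      have 1: "((\<lambda>r. cnj (\<eta> r)) has_vector_derivative cnj (rderiv \<eta> r)) (at r)"
        using \<eta>'[of r] that sub by (intro has_vector_derivative_cnj) auto
      have 2: "(complex_of_real has_vector_derivative 1) (at r)"
        using has_vector_derivative_of_real[OF DERIV_ident] by simp
      from has_vector_derivative_mult[OF 2 1] show ?thesis
        by (simp add: v_def[abs_def] v'_def algebra_simps)
    qed
    have u': "set_integrable lebesgue {a..b} (rderiv (rderiv \<phi>))"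
      using \<phi>1(2) ab by (auto simp: locally_ac_def)
    have iu'v: "set_integrable lebesgue {a..b} (\<lambda>r. rderiv (rderiv \<phi>) r * v r)"
    proof -
      have "set_integrable lebesgue {a..b} (\<lambda>r. v r * rderiv (rderiv \<phi>) r)"
      proof (rule absolutely_integrable_bounded_measurable_product[where h = "(*)"])
        show "bilinear ((*) :: complex \<Rightarrow> complex \<Rightarrow> complex)"
          by (rule bilinear_times)
        show "v \<in> borel_measurable (lebesgue_on {a..b})"
          by (rule continuous_imp_measurable_on_sets_lebesgue[OF cv(1)]) simp
        show "bounded (v ` {a..b})"
          by (intro compact_imp_bounded compact_continuous_image cv) simp
      qed (use u' in auto)
      then show ?thesis by (simp add: mult.commute)
    qed
    have iuv': "set_integrable lebesgue {a..b} (\<lambda>r. rderiv \<phi> r * v' r)"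
      by (intro absolutely_integrable_continuous_real continuous_intros cv)
    have "(LINT r:{a..b}|lebesgue. rderiv (rderiv \<phi>) r * v r + rderiv \<phi> r * v' r)
        = rderiv \<phi> b * v b - rderiv \<phi> a * v a"
    proof (rule set_lebesgue_integral_by_parts[OF ab(2) u' _ _ _ iu'v iuv'])
      show "set_integrable lebesgue {a..b} v'"
        by (intro absolutely_integrable_continuous_real cv)
      show "(LINT r:{x..y}|lebesgue. rderiv (rderiv \<phi>) r) = rderiv \<phi> y - rderiv \<phi> x"
        if "a \<le> x" "x \<le> y" "y \<le> b" for x y
        using \<phi>1(2) that ab by (auto simp: locally_ac_def)
      show "(LINT r:{x..y}|lebesgue. v' r) = v y - v x" if "a \<le> x" "x \<le> y" "y \<le> b" for x y
        using that by (intro set_integral_FTC dv continuous_on_subset[OF cv(2)]) auto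
    qed
    moreover have "(LINT r:{a..b}|lebesgue. Q r)
        = (LINT r:{a..b}|lebesgue. rderiv (rderiv \<phi>) r * v r + rderiv \<phi> r * v' r)"
    proof (rule set_lebesgue_integral_cong)
      show "\<forall>r. r \<in> {a..b} \<longrightarrow> Q r = rderiv (rderiv \<phi>) r * v r + rderiv \<phi> r * v' r"
      proof (intro allI impI)
        fix r assume "r \<in> {a..b}"
        then have "r > 0" using ab by auto
        then show "Q r = rderiv (rderiv \<phi>) r * v r + rderiv \<phi> r * v' r"
          by (simp add: Q_def laplace_k_def H1_pair_def v_def v'_def field_simps)
      qed
    qed simp
    ultimately show ?thesis by (simp add: w_def v_def)
  qed
  have "\<exists>a. 0 < a \<and> a < 1 / (real n + 2) \<and> cmod (w a) < 1 / (real n + 1)" for n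
  proof -
    \<comment> \<open>By Young's inequality \<open>a * h a\<close> dominates
      \<open>cmod (w a)\<close>: the factor \<open>a\<close> times the density contains both
      \<open>(a * cmod (rderiv \<phi> a))^2\<close> and, since \<open>k^2 \<ge> 1\<close>, the
      square of \<open>cmod (\<eta> a)\<close>.\<close>
    define h where "h r = H1_density k \<phi> r + H1_density k \<eta> r" for r
    have "integrable leb01 h" using \<phi>1(1) \<eta>(1) by (simp add: h_def[abs_def] H1_space_iff)
    then obtain a where a: "0 < a" "a < 1 / (real n + 2)" "a * h a < 1 / (real n + 1)"
      using integrable_leb01_small[of h "1 / (real n + 1)" "1 / (real n + 2)"]
      by (auto simp: h_def H1_density_nonneg add_nonneg_nonneg)
    have k2: "1 \<le> (of_int k :: real)\<^sup>2"
    proof -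
      have "1 \<le> k\<^sup>2" using k zero_less_power2[of k] by linarith
      then have "real_of_int 1 \<le> of_int (k\<^sup>2)" by (simp only: of_int_le_iff)
      then show ?thesis by simp
    qed
    have aH: "a * H1_density k u a = (a * cmod (rderiv u a))\<^sup>2 + (cmod (u a))\<^sup>2 * (of_int k)\<^sup>2" for u
      using a(1) by (simp add: H1_density_def field_simps power2_eq_square)
    have "(a * cmod (rderiv \<phi> a)) * cmod (\<eta> a) \<le> (a * cmod (rderiv \<phi> a))\<^sup>2 + (cmod (\<eta> a))\<^sup>2"
    proof -
      define x y where "x = a * cmod (rderiv \<phi> a)" and "y = cmod (\<eta> a)"
      have "0 \<le> x * y" using a(1) by (simp add: x_def y_def)
      moreover have "2 * (x * y) \<le> x\<^sup>2 + y\<^sup>2" using sum_squares_bound[of x y] by (simp add: mult.assoc)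
      ultimately have "x * y \<le> x\<^sup>2 + y\<^sup>2" by linarith
      then show ?thesis by (simp add: x_def y_def)
    qed
    moreover have "(a * cmod (rderiv \<phi> a))\<^sup>2 \<le> a * H1_density k \<phi> a"
      unfolding aH by simp
    moreover have "(cmod (\<eta> a))\<^sup>2 \<le> a * H1_density k \<eta> a"
    proof -
      have "(cmod (\<eta> a))\<^sup>2 * 1 \<le> (cmod (\<eta> a))\<^sup>2 * (of_int k)\<^sup>2"
        using k2 by (intro mult_left_mono) auto
      then show ?thesis unfolding aH by (simp add: add_increasing)
    qed
    ultimately have "(a * cmod (rderiv \<phi> a)) * cmod (\<eta> a) \<le> a * H1_density k \<phi> a + a * H1_density k \<eta> a"
      by linarith
    then have "cmod (w a) \<le> a * h a"
      using a(1) by (simp add: w_def h_def norm_mult distrib_left mult_ac)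
    then show ?thesis using a by force
  qed
  then obtain A where A: "\<And>n. 0 < A n" "\<And>n. A n < 1 / (real n + 2)" "\<And>n. cmod (w (A n)) < 1 / (real n + 1)"
    by metis
  have "(w \<longlongrightarrow> 0) (at_left 1)"
  proof -
    \<comment> \<open>The test function satisfies no boundary condition, so its boundedness is
      combined with the decay of \<open>rderiv \<phi>\<close>.\<close>
    obtain C where C: "0 \<le> C" "\<And>r. 1 / 2 \<le> r \<Longrightarrow> r < 1 \<Longrightarrow> cmod (\<eta> r) \<le> C"
      using C1_01_bounded_near_1[OF \<eta>(1,2)] by blast
    have "\<forall>\<^sub>F r in at_left 1. cmod (w r) \<le> cmod (rderiv \<phi> r) * C"
    proof -
      have "\<forall>\<^sub>F r in at_left (1::real). r \<in> {1/2<..<1}"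
        by (rule eventually_at_left_real) simp
      then show ?thesis
      proof eventually_elim
        case (elim r)
        have "r * cmod (\<eta> r) \<le> 1 * C" using elim C by (intro mult_mono) auto
        then show ?case using elim by (auto simp: w_def norm_mult intro!: mult_left_mono)
      qed
    qed
    then show ?thesis by (rule tendsto_0_le[OF \<phi>1(4)])
  qed
  then have "\<exists>b. 1 - 1 / (real n + 2) < b \<and> b < 1 \<and> cmod (w b) < 1 / (real n + 1)" for n
  proof -
    assume "(w \<longlongrightarrow> 0) (at_left 1)"
    then have "\<forall>\<^sub>F b in at_left 1. cmod (w b) < 1 / (real n + 1)"
      by (auto dest!: tendstoD[where e = "1 / (real n + 1)"])
    moreover have "\<forall>\<^sub>F b in at_left 1. b \<in> {1 - 1 / (real n + 2)<..<1}"
      by (rule eventually_at_left_real) simp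
    ultimately have "\<forall>\<^sub>F b in at_left 1. 1 - 1 / (real n + 2) < b \<and> b < 1 \<and> cmod (w b) < 1 / (real n + 1)"
      by eventually_elim auto
    then show ?thesis by (rule eventually_happens'[rotated]) simp
  qed
  then obtain B where B: "\<And>n. 1 - 1 / (real n + 2) < B n" "\<And>n. B n < 1" "\<And>n. cmod (w (B n)) < 1 / (real n + 1)"
    by metis
  \<comment> \<open>The \<open>2\<close> in \<open>1 / (real n + 2)\<close> keeps \<open>A n\<close>
    below and \<open>B n\<close> above the midpoint \<open>1 / 2\<close>.\<close>
  have AB: "A n \<le> B n" for n
  proof -
    have "1 / (real n + 2) \<le> 1 / 2" by (simp add: field_simps)
    then show ?thesis using A(2)[of n] B(1)[of n] by linarith
  qed
  have lim: "(\<lambda>n. 1 / (real n + c)) \<longlonglongrightarrow> 0" for c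
    using tendsto_divide_0[OF tendsto_const filterlim_at_top_imp_at_infinity[OF
        filterlim_tendsto_add_at_top[OF tendsto_const filterlim_real_sequentially]], of 1 c]
    by (simp add: add.commute)
  have wA: "(\<lambda>n. w (A n)) \<longlonglongrightarrow> 0" and wB: "(\<lambda>n. w (B n)) \<longlonglongrightarrow> 0"
    using A(3) B(3) by (auto intro!: Lim_null_comparison[OF _ lim[of 1]] always_eventually less_imp_le)
  \<comment> \<open>The intervals need not be nested; since every interior point eventually belongs
    to them, dominated convergence applies with \<open>Q\<close> itself as majorant.\<close>
  have "(\<lambda>n. LINT r:{A n..B n}|lebesgue. Q r) \<longlonglongrightarrow> (LINT r:{0<..<1}|lebesgue. Q r)"
    unfolding set_lebesgue_integral_def
  proof (rule integral_dominated_convergence)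
    show "integrable lebesgue (\<lambda>r. norm (indicator {0<..<1} r *\<^sub>R Q r))"
      using iQ' unfolding set_integrable_def by (rule integrable_norm)
    show "(\<lambda>r. indicator {0<..<1} r *\<^sub>R Q r) \<in> borel_measurable lebesgue"
      using iQ' unfolding set_integrable_def by auto
    show "(\<lambda>r. indicator {A n..B n} r *\<^sub>R Q r) \<in> borel_measurable lebesgue" for n
    proof -
      have "set_integrable lebesgue {A n..B n} Q"
        using iQ' by (rule set_integrable_subset) (use A(1)[of n] B(2)[of n] in auto)
      then show ?thesis unfolding set_integrable_def by auto
    qed
    show "AE r in lebesgue. (\<lambda>n. indicator {A n..B n} r *\<^sub>R Q r) \<longlonglongrightarrow> indicator {0<..<1} r *\<^sub>R Q r"
    proof (rule AE_I2)
      fix r :: real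
      show "(\<lambda>n. indicator {A n..B n} r *\<^sub>R Q r) \<longlonglongrightarrow> indicator {0<..<1} r *\<^sub>R Q r"
      proof (cases "r \<in> {0<..<1}")
        case True
        have "\<forall>\<^sub>F n in sequentially. 1 / (real n + 2) < min r (1 - r)"
          using True by (intro order_tendstoD(2)[OF lim]) auto
        then have "\<forall>\<^sub>F n in sequentially. indicator {0<..<1} r *\<^sub>R Q r = indicator {A n..B n} r *\<^sub>R Q r"
        proof eventually_elim
          case (elim n)
          then have "r \<in> {A n..B n}" using A(2)[of n] B(1)[of n] by auto
          then show ?case using True by simp
        qed
        then show ?thesis by (rule Lim_transform_eventually[OF tendsto_const])
      next
        case False
        then have "r \<notin> {A n..B n}" for n using A(1)[of n] B(2)[of n] by auto
        then show ?thesis using False by simp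
      qed
    qed
    show "AE r in lebesgue. norm (indicator {A n..B n} r *\<^sub>R Q r) \<le> norm (indicator {0<..<1} r *\<^sub>R Q r)" for n
      using A(1)[of n] B(2)[of n] by (intro AE_I2) (auto simp: indicator_def)
  qed
  moreover have "(\<lambda>n. LINT r:{A n..B n}|lebesgue. Q r) \<longlonglongrightarrow> 0 - 0"
    using Q_ab[OF A(1) AB B(2)] tendsto_diff[OF wB wA] by simp
  ultimately have "(LINT r:{0<..<1}|lebesgue. Q r) = 0"
    using LIMSEQ_unique by fastforce
  then have "integral\<^sup>L leb01 Q = 0"
    by (simp add: integral_restrict_space set_lebesgue_integral_def)
  moreover have "integral\<^sup>L leb01 Q = H_inner (laplace_k k \<phi>) \<eta> + integral\<^sup>L leb01 (H1_pair k \<phi> \<eta>)"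
    unfolding Q_def[abs_def] H_inner_eq using iL iP by (rule Bochner_Integration.integral_add)
  ultimately show ?thesis by (simp add: eq_neg_iff_add_eq_0)
qed

section \<open>Transport by the shear flow\<close>

lemma H_norm_bounded_mult:
  assumes "x \<in> H_space" "m \<in> borel_measurable leb01" "\<And>r. 0 < r \<Longrightarrow> r < 1 \<Longrightarrow> cmod (m r) \<le> C" "0 \<le> C"
  shows "H_norm (\<lambda>r. m r * x r) \<le> C * H_norm x"
proof (rule power2_le_imp_le)
  have "(H_norm (\<lambda>r. m r * x r))\<^sup>2 \<le> (\<integral>r. C\<^sup>2 * ((cmod (x r))\<^sup>2 * r) \<partial>leb01)"
    unfolding H_norm_power2
  proof (rule integral_mono)
    show "integrable leb01 (\<lambda>r. (cmod (m r * x r))\<^sup>2 * r)"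
      using H_space_bounded_mult[of x m C] assms by (simp add: H_space_iff)
    show "integrable leb01 (\<lambda>r. C\<^sup>2 * ((cmod (x r))\<^sup>2 * r))"
      using assms(1) by (simp add: H_space_iff)
    fix r assume "r \<in> space leb01"
    then have r: "0 < r" "r < 1" by auto
    then have "(cmod (m r))\<^sup>2 \<le> C\<^sup>2" using assms(3) by (intro power_mono) auto
    then have "(cmod (m r))\<^sup>2 * ((cmod (x r))\<^sup>2 * r) \<le> C\<^sup>2 * ((cmod (x r))\<^sup>2 * r)"
      using r by (intro mult_right_mono) auto
    then show "(cmod (m r * x r))\<^sup>2 * r \<le> C\<^sup>2 * ((cmod (x r))\<^sup>2 * r)"
      by (simp add: norm_mult power_mult_distrib mult_ac)
  qed
  then show "(H_norm (\<lambda>r. m r * x r))\<^sup>2 \<le> (C * H_norm x)\<^sup>2"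
    by (simp add: power_mult_distrib H_norm_power2)
qed (use assms in simp)

lemma H1_norm_power2: "(H1_norm k \<phi>)\<^sup>2 = integral\<^sup>L leb01 (H1_density k \<phi>)"
  unfolding H1_norm_eq
  by (intro real_sqrt_pow2 integral_nonneg_AE) (auto intro!: AE_I2 H1_density_nonneg)

lemma H1_norm_nonneg [simp]: "0 \<le> H1_norm k \<phi>"
  unfolding H1_norm_eq
  by (intro real_sqrt_ge_zero integral_nonneg_AE) (auto intro!: AE_I2 H1_density_nonneg)

text \<open>The transport term moved to the right-hand side: a purely imaginary multiplier whose
  exponential is the inviscid flow.\<close>

definition potential :: "real \<Rightarrow> int \<Rightarrow> real \<Rightarrow> complex"
  where "potential \<alpha> k r = - \<i> * of_int k * of_real (r powr \<alpha>)"

lemma cnj_potential: "cnj (potential \<alpha> k r) = - potential \<alpha> k r"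
  by (simp add: potential_def)

lemma Re_potential [simp]: "Re (potential \<alpha> k r) = 0"
  by (simp add: potential_def)

lemma potential_continuous: "continuous_on {0<..<1} (potential \<alpha> k)"
  unfolding potential_def[abs_def] by (intro continuous_intros) auto

lemma potential_measurable: "potential \<alpha> k \<in> borel_measurable leb01"
  by (intro borel_measurable_leb01_continuous potential_continuous)

lemma cmod_potential_le:
  assumes "0 \<le> \<alpha>" "0 < r" "r < 1"
  shows "cmod (potential \<alpha> k r) \<le> \<bar>of_int k\<bar>"
proof -
  have "r powr \<alpha> \<le> 1" using assms by (intro powr_le1) auto
  then have "\<bar>of_int k\<bar> * r powr \<alpha> \<le> \<bar>of_int k\<bar> * 1" by (intro mult_left_mono) auto
  then show ?thesis by (simp add: potential_def norm_mult)
qed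

lemma potential_H_space:
  assumes "0 \<le> \<alpha>" "x \<in> H_space"
  shows "(\<lambda>r. potential \<alpha> k r * x r) \<in> H_space"
  by (rule H_space_bounded_mult[OF assms(2) potential_measurable cmod_potential_le]) (use assms in auto)

text \<open>Skew-symmetry, because the multiplier is imaginary. It removes transport from both the
  energy and the correlation balance.\<close>

lemma H_inner_potential: "H_inner x (\<lambda>r. potential \<alpha> k r * y r) = - H_inner (\<lambda>r. potential \<alpha> k r * x r) y"
proof -
  have "H_inner x (\<lambda>r. potential \<alpha> k r * y r) = H_inner (\<lambda>r. -1 * (potential \<alpha> k r * x r)) y"
    unfolding H_inner_eq by (simp add: cnj_potential mult_ac)
  then show ?thesis by (simp only: H_inner_scale_left) simp
qed

lemma adv_diff_rhs_eq:
  "adv_diff_rhs \<alpha> k \<nu> \<phi> = (\<lambda>r. of_real \<nu> * laplace_k k \<phi> r + potential \<alpha> k r * \<phi> r)"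
  by (simp add: adv_diff_rhs_def potential_def fun_eq_iff)

lemma inviscid_eq: "inviscid \<alpha> k \<phi> t r = exp (of_real t * potential \<alpha> k r) * \<phi> r"
  by (simp add: inviscid_def potential_def mult_ac)

lemma cmod_exp_potential: "cmod (exp (of_real t * potential \<alpha> k r)) = 1"
  by (simp add: norm_exp_eq_Re potential_def)

lemma exp_potential_measurable: "(\<lambda>r. exp (of_real t * potential \<alpha> k r)) \<in> borel_measurable leb01"
  by (intro borel_measurable_leb01_continuous continuous_intros potential_continuous)

lemma inviscid_H_space:
  assumes "\<phi> \<in> H_space"
  shows "inviscid \<alpha> k \<phi> t \<in> H_space"
proof -
  have "(\<lambda>r. exp (of_real t * potential \<alpha> k r) * \<phi> r) \<in> H_space"
    by (rule H_space_bounded_mult[OF assms exp_potential_measurable, of _ _ _ 1])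
       (simp add: cmod_exp_potential)
  then show ?thesis by (simp add: inviscid_eq[abs_def])
qed

text \<open>The generator is bounded by \<open>|k|\<close>, so the second-order Taylor remainder of
  the exponential gives an error of size \<open>|h| * k^2\<close>. The shift \<open>c\<close> allows
  the flow to start at a time other than zero.\<close>

lemma inviscid_H_deriv_at:
  assumes \<phi>: "\<phi> \<in> H_space" and \<alpha>: "0 \<le> \<alpha>"
  shows "H_deriv_at (\<lambda>s. inviscid \<alpha> k \<phi> (s - c)) (\<lambda>r. potential \<alpha> k r * inviscid \<alpha> k \<phi> (t - c) r) t"
  unfolding H_deriv_at_def
proof (rule tendsto_0_le[where K = "(of_int k)\<^sup>2 * H_norm (inviscid \<alpha> k \<phi> (t - c))"])
  show "((\<lambda>h. h) \<longlongrightarrow> 0) (at (0::real))" by (rule tendsto_ident_at)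
  let ?g = "inviscid \<alpha> k \<phi> (t - c)"
  have bound: "H_norm (\<lambda>r. (inviscid \<alpha> k \<phi> (t + h - c) r - ?g r) / of_real h - potential \<alpha> k r * ?g r)
      \<le> (\<bar>h\<bar> * (of_int k)\<^sup>2) * H_norm ?g" if h: "h \<noteq> 0" for h
  proof -
    define m where "m r = (exp (of_real h * potential \<alpha> k r) - 1) / of_real h - potential \<alpha> k r" for r
    have "(\<lambda>r. (inviscid \<alpha> k \<phi> (t + h - c) r - ?g r) / of_real h - potential \<alpha> k r * ?g r) = (\<lambda>r. m r * ?g r)"
    proof
      fix r
      have "exp (of_real (t + h - c) * potential \<alpha> k r)
          = exp (of_real h * potential \<alpha> k r) * exp (of_real (t - c) * potential \<alpha> k r)"
        by (simp add: exp_add[symmetric] algebra_simps)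
      then show "(inviscid \<alpha> k \<phi> (t + h - c) r - ?g r) / of_real h - potential \<alpha> k r * ?g r = m r * ?g r"
        unfolding inviscid_eq m_def by (simp add: field_simps h)
    qed
    moreover have "H_norm (\<lambda>r. m r * ?g r) \<le> (\<bar>h\<bar> * (of_int k)\<^sup>2) * H_norm ?g"
    proof (rule H_norm_bounded_mult)
      show "?g \<in> H_space" using \<phi> by (rule inviscid_H_space)
      show "m \<in> borel_measurable leb01"
        unfolding m_def[abs_def] using h
        by (intro borel_measurable_leb01_continuous continuous_intros potential_continuous) auto
      fix r :: real assume r: "0 < r" "r < 1"
      define z where "z = of_real h * potential \<alpha> k r"
      \<comment> \<open>On the imaginary axis the exponential factor in the Taylor bound equals
        one.\<close>
      have "Re z = 0" by (simp add: z_def potential_def)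
      then have "cmod (exp z - (1 + z)) \<le> (cmod z)\<^sup>2"
        using Taylor_exp[of z 1] by (simp add: numeral_2_eq_2)
      moreover have "m r = (exp z - (1 + z)) / of_real h"
        using h by (simp add: m_def z_def field_simps)
      moreover have "(cmod z)\<^sup>2 / \<bar>h\<bar> = \<bar>h\<bar> * (cmod (potential \<alpha> k r))\<^sup>2"
        using h by (simp add: z_def norm_mult power2_eq_square)
      ultimately have "cmod (m r) \<le> \<bar>h\<bar> * (cmod (potential \<alpha> k r))\<^sup>2"
        using h by (simp add: norm_divide) (metis abs_ge_zero divide_right_mono)
      also have "\<dots> \<le> \<bar>h\<bar> * \<bar>of_int k\<bar>\<^sup>2"
        using cmod_potential_le[OF \<alpha> r, of k] by (intro mult_left_mono power_mono) auto
      finally show "cmod (m r) \<le> \<bar>h\<bar> * (of_int k)\<^sup>2" by simp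
    qed simp
    ultimately show ?thesis by simp
  qed
  show "\<forall>\<^sub>F h in at 0. norm (H_norm (\<lambda>r. (inviscid \<alpha> k \<phi> (t + h - c) r - ?g r) / of_real h - potential \<alpha> k r * ?g r))
      \<le> norm h * ((of_int k)\<^sup>2 * H_norm ?g)"
    using eventually_neq_at_within[of 0 0 UNIV]
    by eventually_elim (use bound in \<open>simp add: mult.assoc\<close>)
qed

text \<open>The phase has modulus one, so only its radial derivative costs anything; that derivative
  is at most \<open>|s| * |k| * \<alpha>\<close>, where \<open>\<alpha> \<ge> 1\<close> keeps
  \<open>r powr (\<alpha> - 1)\<close> bounded near \<open>0\<close>.\<close>

lemma inviscid_H1:
  assumes \<phi>: "\<phi> \<in> H1_space k" "C1_01 \<phi>" "\<phi> \<in> H_space" and \<alpha>: "1 \<le> \<alpha>"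
  shows "inviscid \<alpha> k \<phi> s \<in> H1_space k" "C1_01 (inviscid \<alpha> k \<phi> s)"
    and "(H1_norm k (inviscid \<alpha> k \<phi> s))\<^sup>2
      \<le> 2 * (H1_norm k \<phi>)\<^sup>2 + 2 * \<alpha>\<^sup>2 * (of_int k)\<^sup>2 * s\<^sup>2 * (H_norm \<phi>)\<^sup>2"
proof -
  let ?g = "inviscid \<alpha> k \<phi> s"
  define e where "e r = exp (of_real s * potential \<alpha> k r)" for r
  define p' where "p' r = - \<i> * of_int k * of_real (\<alpha> * r powr (\<alpha> - 1))" for r
  define g' where "g' r = e r * (rderiv \<phi> r + of_real s * p' r * \<phi> r)" for r
  have p': "(potential \<alpha> k has_vector_derivative p' r) (at r)" if "r \<in> {0<..<1}" for r
  proof -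
    have "((\<lambda>r. r powr \<alpha>) has_real_derivative \<alpha> * r powr (\<alpha> - 1)) (at r)"
      using that by (intro has_real_derivative_powr) auto
    from has_vector_derivative_mult_right[OF has_vector_derivative_of_real[OF this], of "- \<i> * of_int k"]
    show ?thesis by (simp add: potential_def[abs_def] p'_def)
  qed
  have e': "(e has_vector_derivative (of_real s * p' r * e r)) (at r)" if "r \<in> {0<..<1}" for r
  proof -
    have 1: "((\<lambda>r. of_real s * potential \<alpha> k r) has_vector_derivative of_real s * p' r) (at r)"
      using p'[OF that] by (rule has_vector_derivative_mult_right)
    have 2: "(exp has_field_derivative e r) (at (of_real s * potential \<alpha> k r))"
      unfolding e_def by (rule DERIV_exp)
    from field_vector_diff_chain_at[OF 1 2] show ?thesis by (simp add: e_def[abs_def] o_def)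
  qed
  have geq: "?g = (\<lambda>r. e r * \<phi> r)" by (simp add: inviscid_eq e_def fun_eq_iff)
  have d: "(?g has_vector_derivative g' r) (at r)" if "r \<in> {0<..<1}" for r
  proof -
    have "(\<phi> has_vector_derivative rderiv \<phi> r) (at r)" using \<phi>(2) that by (simp add: C1_01_def)
    from has_vector_derivative_mult[OF e'[OF that] this] show ?thesis
      unfolding geq by (simp add: g'_def algebra_simps)
  qed
  have c: "continuous_on {0<..<1} g'"
  proof -
    have 1: "continuous_on {0<..<1} e" unfolding e_def[abs_def]
      by (intro continuous_intros potential_continuous)
    have 2: "continuous_on {0<..<1} p'" unfolding p'_def[abs_def]
      by (intro continuous_intros) auto
    show ?thesis unfolding g'_def[abs_def]
      using \<phi>(2) C1_01_continuous_on[OF \<phi>(2)]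
      by (intro continuous_intros 1 2) (simp_all add: C1_01_def)
  qed
  have rd: "rderiv ?g r = g' r" if "r \<in> {0<..<1}" for r
    using C1_locally_ac(2)[OF d c that] .
  show C1: "C1_01 ?g"
    unfolding C1_01_def
  proof
    show "continuous_on {0<..<1} (rderiv ?g)"
      using c by (rule continuous_on_eq) (simp add: rd)
    show "\<forall>r\<in>{0<..<1}. (?g has_vector_derivative rderiv ?g r) (at r)"
      using d rd by simp
  qed
  \<comment> \<open>The majorant from \<open>(x + y)^2 \<le> 2 x^2 + 2 y^2\<close>. The angular part
    is doubled as well, so that the full density of \<open>\<phi>\<close> appears.\<close>
  define M where "M r = 2 * H1_density k \<phi> r + 2 * \<alpha>\<^sup>2 * (of_int k)\<^sup>2 * s\<^sup>2 * ((cmod (\<phi> r))\<^sup>2 * r)" for r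
  have iM: "integrable leb01 M"
    using \<phi> by (simp add: M_def[abs_def] H1_space_iff H_space_iff)
  have le: "H1_density k ?g r \<le> M r" if r: "0 < r" "r < 1" for r
  proof -
    have e1: "cmod (e r) = 1" by (simp add: e_def cmod_exp_potential)
    have "r powr (\<alpha> - 1) \<le> 1" using r \<alpha> by (intro powr_le1) auto
    then have "\<bar>of_int k\<bar> * (\<alpha> * r powr (\<alpha> - 1)) \<le> \<bar>of_int k\<bar> * (\<alpha> * 1)"
      using \<alpha> by (intro mult_left_mono) auto
    then have "cmod (p' r) \<le> \<bar>of_int k\<bar> * \<alpha>"
      using \<alpha> by (simp add: p'_def norm_mult)
    then have "cmod (of_real s * p' r * \<phi> r) \<le> \<bar>s\<bar> * (\<bar>of_int k\<bar> * \<alpha>) * cmod (\<phi> r)"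
      by (auto simp: norm_mult intro!: mult_right_mono mult_left_mono)
    then have b2: "(cmod (of_real s * p' r * \<phi> r))\<^sup>2 \<le> (\<bar>s\<bar> * (\<bar>of_int k\<bar> * \<alpha>) * cmod (\<phi> r))\<^sup>2"
      by (intro power_mono) auto
    have "(cmod (rderiv ?g r))\<^sup>2 = (cmod (rderiv \<phi> r + of_real s * p' r * \<phi> r))\<^sup>2"
      using r by (simp add: rd g'_def norm_mult e1)
    also have "\<dots> \<le> (cmod (rderiv \<phi> r) + cmod (of_real s * p' r * \<phi> r))\<^sup>2"
      by (intro power_mono norm_triangle_ineq) auto
    also have "\<dots> \<le> 2 * (cmod (rderiv \<phi> r))\<^sup>2 + 2 * (cmod (of_real s * p' r * \<phi> r))\<^sup>2"
      using sum_squares_bound[of "cmod (rderiv \<phi> r)" "cmod (of_real s * p' r * \<phi> r)"]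
      by (simp only: power2_sum)
    finally have b3: "(cmod (rderiv ?g r))\<^sup>2
        \<le> 2 * (cmod (rderiv \<phi> r))\<^sup>2 + 2 * (\<bar>s\<bar> * (\<bar>of_int k\<bar> * \<alpha>) * cmod (\<phi> r))\<^sup>2"
      using b2 by linarith
    define q where "q = (of_int k)\<^sup>2 / r\<^sup>2 * (cmod (\<phi> r))\<^sup>2"
    have q: "0 \<le> q" by (simp add: q_def)
    have "cmod (?g r) = cmod (\<phi> r)" by (simp add: geq norm_mult e1)
    then have "H1_density k ?g r = ((cmod (rderiv ?g r))\<^sup>2 + q) * r"
      by (simp add: H1_density_def q_def)
    also have "\<dots> \<le> (2 * (cmod (rderiv \<phi> r))\<^sup>2 + 2 * (\<bar>s\<bar> * (\<bar>of_int k\<bar> * \<alpha>) * cmod (\<phi> r))\<^sup>2 + 2 * q) * r"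
      using b3 q r by (intro mult_right_mono) auto
    also have "\<dots> = M r"
      unfolding M_def H1_density_def q_def[symmetric]
      by (simp add: power_mult_distrib algebra_simps)
    finally show ?thesis .
  qed
  have iD: "integrable leb01 (H1_density k ?g)"
  proof (rule Bochner_Integration.integrable_bound[OF iM])
    note [measurable] = C1_01_measurable[OF C1]
    have 1: "(\<lambda>r. (of_int k)\<^sup>2 / r\<^sup>2 :: real) \<in> borel_measurable leb01"
      by (intro borel_measurable_leb01_continuous continuous_intros) auto
    show "H1_density k ?g \<in> borel_measurable leb01"
      unfolding H1_density_def[abs_def] by (intro borel_measurable_times borel_measurable_add 1) measurable
    show "AE r in leb01. norm (H1_density k ?g r) \<le> norm (M r)"
      using AE_leb01
    proof eventually_elim
      case (elim r)
      then show ?case using le[of r] H1_density_nonneg[of r k ?g] by simp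
    qed
  qed
  then show "?g \<in> H1_space k"
    using C1_locally_ac(1)[OF d c] by (simp add: H1_space_iff)
  have "(H1_norm k ?g)\<^sup>2 \<le> integral\<^sup>L leb01 M"
    unfolding H1_norm_power2 using iD iM by (rule integral_mono) (use le in auto)
  also have "\<dots> = 2 * (H1_norm k \<phi>)\<^sup>2 + 2 * \<alpha>\<^sup>2 * (of_int k)\<^sup>2 * s\<^sup>2 * (H_norm \<phi>)\<^sup>2"
    using \<phi> by (simp add: M_def[abs_def] H1_space_iff H_space_iff H1_norm_power2 H_norm_power2)
  finally show "(H1_norm k ?g)\<^sup>2 \<le> 2 * (H1_norm k \<phi>)\<^sup>2 + 2 * \<alpha>\<^sup>2 * (of_int k)\<^sup>2 * s\<^sup>2 * (H_norm \<phi>)\<^sup>2" .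
qed

text \<open>Young's inequality applied pointwise. The additive form with free
  \<open>\<epsilon>\<close> lets the contribution of \<open>\<phi>\<close> be absorbed by the energy
  dissipation.\<close>

lemma Re_H1_pair_le:
  assumes "\<phi> \<in> H1_space k" "C1_01 \<phi>" "\<eta> \<in> H1_space k" "C1_01 \<eta>" "0 < \<epsilon>"
  shows "Re (integral\<^sup>L leb01 (H1_pair k \<phi> \<eta>)) \<le> \<epsilon> * (H1_norm k \<phi>)\<^sup>2 + (H1_norm k \<eta>)\<^sup>2 / (4 * \<epsilon>)"
proof -
  have young: "cmod x * cmod y \<le> \<epsilon> * (cmod x)\<^sup>2 + (cmod y)\<^sup>2 / (4 * \<epsilon>)" for x y :: complex
  proof -
    have "0 \<le> (2 * \<epsilon> * cmod x - cmod y)\<^sup>2 / (4 * \<epsilon>)" using assms(5) by simp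
    also have "\<dots> = \<epsilon> * (cmod x)\<^sup>2 + (cmod y)\<^sup>2 / (4 * \<epsilon>) - cmod x * cmod y"
      using assms(5) by (simp add: power2_eq_square field_simps)
    finally show ?thesis by simp
  qed
  have int: "integrable leb01 (H1_pair k \<phi> \<eta>)" using assms by (intro H1_pair_integrable)
  have "Re (integral\<^sup>L leb01 (H1_pair k \<phi> \<eta>)) = (\<integral>r. Re (H1_pair k \<phi> \<eta> r) \<partial>leb01)"
    using int by simp
  also have "\<dots> \<le> (\<integral>r. \<epsilon> * H1_density k \<phi> r + H1_density k \<eta> r / (4 * \<epsilon>) \<partial>leb01)"
  proof (rule integral_mono)
    show "integrable leb01 (\<lambda>r. Re (H1_pair k \<phi> \<eta> r))" using int by simp
    show "integrable leb01 (\<lambda>r. \<epsilon> * H1_density k \<phi> r + H1_density k \<eta> r / (4 * \<epsilon>))"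
      using assms by (simp add: H1_space_iff)
    fix r assume "r \<in> space leb01"
    then have r: "0 < r" by simp
    define c where "c = (of_int k)\<^sup>2 / r\<^sup>2"
    have c: "0 \<le> c" by (simp add: c_def)
    define A where "A = \<epsilon> * (cmod (rderiv \<phi> r))\<^sup>2 + (cmod (rderiv \<eta> r))\<^sup>2 / (4 * \<epsilon>)"
    define B where "B = \<epsilon> * (cmod (\<phi> r))\<^sup>2 + (cmod (\<eta> r))\<^sup>2 / (4 * \<epsilon>)"
    let ?X = "rderiv \<phi> r * cnj (rderiv \<eta> r) + of_real c * \<phi> r * cnj (\<eta> r)"
    have "cmod ?X \<le> cmod (rderiv \<phi> r) * cmod (rderiv \<eta> r) + c * (cmod (\<phi> r) * cmod (\<eta> r))"
      using c by (intro order_trans[OF norm_triangle_ineq]) (simp add: norm_mult)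
    also have "\<dots> \<le> A + c * B"
      using c young by (intro add_mono mult_left_mono) (auto simp: A_def B_def)
    finally have X: "Re ?X \<le> A + c * B" using complex_Re_le_cmod[of ?X] by linarith
    have "Re (H1_pair k \<phi> \<eta> r) = Re ?X * r"
      unfolding H1_pair_def c_def[symmetric] by simp
    also have "\<dots> \<le> (A + c * B) * r" using X r by (intro mult_right_mono) auto
    also have "\<dots> = \<epsilon> * H1_density k \<phi> r + H1_density k \<eta> r / (4 * \<epsilon>)"
      unfolding H1_density_def c_def[symmetric] A_def B_def using assms(5) by (simp add: field_simps)
    finally show "Re (H1_pair k \<phi> \<eta> r) \<le> \<epsilon> * H1_density k \<phi> r + H1_density k \<eta> r / (4 * \<epsilon>)" .
  qed
  also have "\<dots> = \<epsilon> * (H1_norm k \<phi>)\<^sup>2 + (H1_norm k \<eta>)\<^sup>2 / (4 * \<epsilon>)"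
    using assms by (simp add: H1_space_iff H1_norm_power2)
  finally show ?thesis .
qed

lemma locally_ac_scale:
  assumes "C1_01 \<eta>"
  shows "locally_ac (\<lambda>r. c * \<eta> r)" "\<And>r. r \<in> {0<..<1} \<Longrightarrow> rderiv (\<lambda>r. c * \<eta> r) r = c * rderiv \<eta> r"
proof -
  have 1: "((\<lambda>r. c * \<eta> r) has_vector_derivative c * rderiv \<eta> r) (at r)" if "r \<in> {0<..<1}" for r
    using assms that by (intro has_vector_derivative_mult_right) (simp add: C1_01_def)
  have 2: "continuous_on {0<..<1} (\<lambda>r. c * rderiv \<eta> r)"
    using assms by (intro continuous_intros) (simp add: C1_01_def)
  show "locally_ac (\<lambda>r. c * \<eta> r)" "\<And>r. r \<in> {0<..<1} \<Longrightarrow> rderiv (\<lambda>r. c * \<eta> r) r = c * rderiv \<eta> r"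
    using C1_locally_ac[OF 1 2] by blast+
qed

text \<open>The dual norm tests only against elements of unit norm, so \<open>\<eta>\<close> is
  normalised first; this is where its norm must be positive.\<close>

lemma mixing_bound_inner:
  assumes mix: "mixing_bound \<alpha> a" and k: "k \<noteq> 0" and s: "0 \<le> s"
    and \<phi>: "\<phi> \<in> H1_space k" and \<eta>: "\<eta> \<in> H1_space k" "C1_01 \<eta>" "0 < H1_norm k \<eta>"
  shows "cmod (H_inner (inviscid \<alpha> k \<phi> s) \<eta>)
    \<le> a * (1 + \<bar>of_int k\<bar> * s) powr (- p_exp \<alpha>) * H1_norm k \<phi> * H1_norm k \<eta>"
proof -
  define c where "c = inverse (H1_norm k \<eta>)"
  have c: "0 < c" using \<eta>(3) by (simp add: c_def)
  let ?\<zeta> = "\<lambda>r. of_real c * \<eta> r"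
  have dens: "H1_density k ?\<zeta> r = c\<^sup>2 * H1_density k \<eta> r" if "r \<in> {0<..<1}" for r
    using that by (simp add: H1_density_def locally_ac_scale(2)[OF \<eta>(2)] norm_mult power_mult_distrib field_simps)
  have "integrable leb01 (\<lambda>r. c\<^sup>2 * H1_density k \<eta> r)"
    using \<eta>(1) by (simp add: H1_space_iff)
  then have "integrable leb01 (H1_density k ?\<zeta>)"
    by (rule Bochner_Integration.integrable_cong[THEN iffD1, rotated 2]) (simp_all add: dens)
  then have \<zeta>: "?\<zeta> \<in> H1_space k"
    using locally_ac_scale(1)[OF \<eta>(2)] by (simp add: H1_space_iff)
  have "(H1_norm k ?\<zeta>)\<^sup>2 = c\<^sup>2 * (H1_norm k \<eta>)\<^sup>2"
    unfolding H1_norm_power2 by (subst integral_mult_right_zero[symmetric])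
      (intro Bochner_Integration.integral_cong, simp_all add: dens)
  also have "\<dots> = 1\<^sup>2" using \<eta>(3) by (simp add: c_def power_mult_distrib[symmetric])
  finally have "H1_norm k ?\<zeta> = 1" by (rule power2_eq_imp_eq) simp_all
  with \<zeta> have "ereal (cmod (H_inner (inviscid \<alpha> k \<phi> s) ?\<zeta>)) \<le> Hm1_norm k (inviscid \<alpha> k \<phi> s)"
    unfolding Hm1_norm_def by (intro SUP_upper) auto
  also have "\<dots> \<le> ereal (a * (1 + \<bar>of_int k\<bar> * s) powr (- p_exp \<alpha>) * H1_norm k \<phi>)"
    using mix k s \<phi> by (simp add: mixing_bound_def)
  finally have "c * cmod (H_inner (inviscid \<alpha> k \<phi> s) \<eta>) \<le> a * (1 + \<bar>of_int k\<bar> * s) powr (- p_exp \<alpha>) * H1_norm k \<phi>"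
    using c by (simp add: H_inner_scale_right norm_mult)
  then show ?thesis using \<eta>(3) by (simp add: c_def field_simps)
qed

section \<open>Energy decay\<close>

lemma of_int_power2_ge_1:
  assumes "k \<noteq> (0::int)"
  shows "1 \<le> (of_int k :: real)\<^sup>2"
proof -
  have "1 \<le> k\<^sup>2" using assms zero_less_power2[of k] by linarith
  then have "real_of_int 1 \<le> of_int (k\<^sup>2)" by (simp only: of_int_le_iff)
  then show ?thesis by simp
qed

text \<open>For a nonzero integer \<open>k\<close> and \<open>r < 1\<close> the weight
  \<open>k^2 / r^2\<close> is at least one.\<close>

lemma H_norm_le_H1_norm:
  assumes "k \<noteq> 0" "\<phi> \<in> H1_space k" "\<phi> \<in> H_space"
  shows "H_norm \<phi> \<le> H1_norm k \<phi>"
proof (rule power2_le_imp_le)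
  show "(H_norm \<phi>)\<^sup>2 \<le> (H1_norm k \<phi>)\<^sup>2"
    unfolding H_norm_power2 H1_norm_power2
  proof (rule integral_mono)
    fix r assume "r \<in> space leb01"
    then have r: "0 < r" "r < 1" by auto
    have "r\<^sup>2 \<le> 1" using r by (intro power_le_one) auto
    then have "1 \<le> (of_int k)\<^sup>2 / r\<^sup>2"
      using of_int_power2_ge_1[OF assms(1)] r by (simp add: field_simps)
    then have "1 * (cmod (\<phi> r))\<^sup>2 \<le> (of_int k)\<^sup>2 / r\<^sup>2 * (cmod (\<phi> r))\<^sup>2"
      by (intro mult_right_mono) auto
    then have "(cmod (\<phi> r))\<^sup>2 \<le> (cmod (rderiv \<phi> r))\<^sup>2 + (of_int k)\<^sup>2 / r\<^sup>2 * (cmod (\<phi> r))\<^sup>2"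
      using zero_le_power2[of "cmod (rderiv \<phi> r)"] by linarith
    then show "(cmod (\<phi> r))\<^sup>2 * r \<le> H1_density k \<phi> r"
      unfolding H1_density_def using r by (intro mult_right_mono) auto
  qed (use assms in \<open>auto simp: H_space_iff H1_space_iff\<close>)
qed simp

lemma H1_pair_self: "integral\<^sup>L leb01 (H1_pair k \<phi> \<phi>) = of_real ((H1_norm k \<phi>)\<^sup>2)"
proof -
  have "integral\<^sup>L leb01 (H1_pair k \<phi> \<phi>) = (\<integral>r. of_real (H1_density k \<phi> r) \<partial>leb01)"
  proof (rule Bochner_Integration.integral_cong)
    fix r
    have "of_real c * \<phi> r * cnj (\<phi> r) = of_real (c * (cmod (\<phi> r))\<^sup>2)" for c
      by (simp only: mult.assoc complex_norm_square[symmetric] of_real_mult)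
    then show "H1_pair k \<phi> \<phi> r = of_real (H1_density k \<phi> r)"
      unfolding H1_pair_def H1_density_def by (simp only: complex_norm_square[symmetric] of_real_mult of_real_add)
  qed simp
  also have "\<dots> = of_real ((H1_norm k \<phi>)\<^sup>2)"
    unfolding H1_norm_power2 by (rule integral_complex_of_real)
  finally show ?thesis .
qed

section \<open>Energy and correlation balances along a viscous solution\<close>

context
  fixes \<alpha> \<nu> :: real and k :: int and f\<^sub>0 :: "real \<Rightarrow> complex" and f :: "real \<Rightarrow> real \<Rightarrow> complex"
  assumes vs: "viscous_solution \<alpha> k \<nu> f\<^sub>0 f" and \<alpha>: "1 \<le> \<alpha>" and k: "k \<noteq> 0" and \<nu>: "0 < \<nu>"
begin

lemma solution_H_space: "0 \<le> t \<Longrightarrow> f t \<in> H_space"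
  using vs by (simp add: viscous_solution_def)

lemma solution_domain:
  assumes "0 < t"
  shows "f t \<in> neumann_domain k" "f t \<in> H1_space k" "C1_01 (f t)" "laplace_k k (f t) \<in> H_space"
  using vs assms neumann_domain_C1_01
  by (auto simp: viscous_solution_def neumann_domain_def)

lemma solution_H_deriv_at: "0 < t \<Longrightarrow> H_deriv_at f (adv_diff_rhs \<alpha> k \<nu> (f t)) t"
  using vs by (simp add: viscous_solution_def H_deriv_at_def)

lemma rhs_H_space: "0 < t \<Longrightarrow> adv_diff_rhs \<alpha> k \<nu> (f t) \<in> H_space"
  unfolding adv_diff_rhs_eq using \<alpha>
  by (intro H_space_add H_space_scale potential_H_space solution_domain solution_H_space) auto

text \<open>The weak form of the equation. The Neumann condition sits in the domain of
  \<open>f t\<close>, so test functions with arbitrary boundary values are admissible.\<close>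

lemma rhs_inner:
  assumes "0 < t" "\<eta> \<in> H1_space k" "C1_01 \<eta>" "\<eta> \<in> H_space"
  shows "H_inner (adv_diff_rhs \<alpha> k \<nu> (f t)) \<eta>
    = - of_real \<nu> * integral\<^sup>L leb01 (H1_pair k (f t) \<eta>) + H_inner (\<lambda>r. potential \<alpha> k r * f t r) \<eta>"
proof -
  have "H_inner (adv_diff_rhs \<alpha> k \<nu> (f t)) \<eta>
      = H_inner (\<lambda>r. of_real \<nu> * laplace_k k (f t) r) \<eta> + H_inner (\<lambda>r. potential \<alpha> k r * f t r) \<eta>"
    unfolding adv_diff_rhs_eq using \<alpha> assms
    by (intro H_inner_add_left H_space_scale potential_H_space solution_domain solution_H_space) auto
  also have "H_inner (\<lambda>r. of_real \<nu> * laplace_k k (f t) r) \<eta>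
      = of_real \<nu> * - integral\<^sup>L leb01 (H1_pair k (f t) \<eta>)"
    unfolding H_inner_scale_left
    by (subst laplace_inner[OF solution_domain(1)[OF assms(1)]
          solution_H_space[OF less_imp_le[OF assms(1)]] assms(2-4) k]) (rule refl)
  finally show ?thesis by simp
qed

lemma eventually_solution_H_space: "0 < t \<Longrightarrow> \<forall>\<^sub>F s in nhds t. f s \<in> H_space"
  by (rule eventually_mono[OF eventually_nhds_in_open[of "{0<..}"]]) (auto intro: solution_H_space)

text \<open>The transport term pairs with \<open>f t\<close> to an imaginary number, and the two
  conjugate viscous terms produce the factor \<open>2\<close>.\<close>

lemma energy_deriv:
  assumes t: "0 < t"
  shows "((\<lambda>s. (H_norm (f s))\<^sup>2) has_real_derivative - 2 * \<nu> * (H1_norm k (f t))\<^sup>2) (at t)"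
proof -
  let ?A = "adv_diff_rhs \<alpha> k \<nu> (f t)" and ?V = "\<lambda>r. potential \<alpha> k r * f t r"
  note ft = solution_domain[OF t] solution_H_space[OF less_imp_le[OF t]]
  have "((\<lambda>s. Re (H_inner (f s) (f s))) has_real_derivative Re (H_inner ?A (f t) + H_inner (f t) ?A)) (at t)"
    using t by (intro Re_H_inner_has_derivative eventually_solution_H_space rhs_H_space solution_H_deriv_at)
  moreover have "H_inner (f t) ?A = cnj (H_inner ?A (f t))" by (rule H_inner_cnj)
  moreover have "Re (H_inner ?V (f t)) = 0"
  proof -
    have "cnj (H_inner ?V (f t)) = - H_inner ?V (f t)"
      using H_inner_potential[of "f t" \<alpha> k "f t"] H_inner_cnj[of "f t" ?V] by simp
    then have "Re (cnj (H_inner ?V (f t))) = Re (- H_inner ?V (f t))" by simp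
    then show ?thesis by simp
  qed
  ultimately show ?thesis
    by (simp add: rhs_inner[OF t ft(2,3,5)] H1_pair_self H_inner_self mult.assoc
        del: of_real_power)
qed

text \<open>By \<open>inviscid_H1\<close> the transported profile is an admissible test function at
  every time; skew-symmetry then cancels the two transport terms.\<close>

lemma correlation_deriv:
  assumes t: "0 < t" and \<phi>: "\<phi> \<in> H1_space k" "C1_01 \<phi>" "\<phi> \<in> H_space"
  shows "((\<lambda>s. Re (H_inner (f s) (inviscid \<alpha> k \<phi> (s - c)))) has_real_derivative
    - \<nu> * Re (integral\<^sup>L leb01 (H1_pair k (f t) (inviscid \<alpha> k \<phi> (t - c))))) (at t)"
proof -
  let ?A = "adv_diff_rhs \<alpha> k \<nu> (f t)" and ?g = "inviscid \<alpha> k \<phi> (t - c)"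
  let ?V = "\<lambda>r. potential \<alpha> k r * f t r" and ?V' = "\<lambda>r. potential \<alpha> k r * ?g r"
  have "((\<lambda>s. Re (H_inner (f s) (inviscid \<alpha> k \<phi> (s - c)))) has_real_derivative
      Re (H_inner ?A ?g + H_inner (f t) ?V')) (at t)"
    using t \<alpha> \<phi>
    by (intro Re_H_inner_has_derivative eventually_solution_H_space rhs_H_space solution_H_deriv_at
        inviscid_H_deriv_at potential_H_space always_eventually allI inviscid_H_space) auto
  moreover have "H_inner ?A ?g + H_inner (f t) ?V' = - of_real \<nu> * integral\<^sup>L leb01 (H1_pair k (f t) ?g)"
    using rhs_inner[OF t inviscid_H1(1,2)[OF \<phi> \<alpha>] inviscid_H_space[OF \<phi>(3)]]
    by (simp add: H_inner_potential)
  ultimately show ?thesis by simp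
qed

text \<open>Includes \<open>t = 0\<close>, where the energy need not be differentiable but where the
  first window begins.\<close>

lemma energy_continuous_on: "continuous_on {0..} (\<lambda>s. (H_norm (f s))\<^sup>2)"
proof -
  have "((\<lambda>s. H_norm (f s)) \<longlongrightarrow> H_norm (f t)) (at t within {0..})" if t: "0 \<le> t" for t
  proof -
    have "((\<lambda>s. H_norm (\<lambda>r. f s r - f t r)) \<longlongrightarrow> 0) (at t within {0..})"
      using vs t by (simp add: viscous_solution_def)
    moreover have "\<forall>\<^sub>F s in at t within {0..}. norm (H_norm (f s) - H_norm (f t))
        \<le> norm (H_norm (\<lambda>r. f s r - f t r)) * 1"
      using eventually_at_topological t
      by (intro eventually_at_filter[THEN iffD2] always_eventually allI impI)
         (auto intro!: H_norm_triangle_diff solution_H_space)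
    ultimately have "((\<lambda>s. H_norm (f s) - H_norm (f t)) \<longlongrightarrow> 0) (at t within {0..})"
      by (rule tendsto_0_le)
    then show ?thesis by (rule LIM_zero_cancel)
  qed
  then show ?thesis
    by (auto simp: continuous_on_def intro!: tendsto_power)
qed

text \<open>Gives a time at which the dissipation equals its average over the interval.\<close>

lemma energy_mvt:
  assumes "0 \<le> u" "u < v"
  obtains z where "u < z" "z < v"
    "(H_norm (f u))\<^sup>2 - (H_norm (f v))\<^sup>2 = 2 * \<nu> * (v - u) * (H1_norm k (f z))\<^sup>2"
proof -
  have c: "continuous_on {u..v} (\<lambda>s. (H_norm (f s))\<^sup>2)"
    using energy_continuous_on by (rule continuous_on_subset) (use assms in auto)
  have "(\<lambda>s. (H_norm (f s))\<^sup>2) differentiable (at x)" if "u < x" "x < v" for x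
    unfolding real_differentiable_def by (rule exI, rule energy_deriv) (use assms(1) that in linarith)
  from MVT[OF assms(2) c this] obtain l z where z: "u < z" "z < v" "((\<lambda>s. (H_norm (f s))\<^sup>2) has_real_derivative l) (at z)"
      "(H_norm (f v))\<^sup>2 - (H_norm (f u))\<^sup>2 = (v - u) * l"
    by blast
  have "l = - 2 * \<nu> * (H1_norm k (f z))\<^sup>2"
    using z assms(1) by (intro DERIV_unique[OF z(3) energy_deriv]) auto
  with z show thesis by (intro that[of z]) (auto simp: algebra_simps)
qed

lemma energy_antimono:
  assumes "0 \<le> u" "u \<le> v"
  shows "(H_norm (f v))\<^sup>2 \<le> (H_norm (f u))\<^sup>2"
proof (cases "u = v")
  case False
  then obtain z where "(H_norm (f u))\<^sup>2 - (H_norm (f v))\<^sup>2 = 2 * \<nu> * (v - u) * (H1_norm k (f z))\<^sup>2"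
    using energy_mvt[of u v] assms by force
  moreover have "0 \<le> 2 * \<nu> * (v - u) * (H1_norm k (f z))\<^sup>2" using \<nu> assms by simp
  ultimately show ?thesis by linarith
qed simp

text \<open>
  \<open>d\<close> is the fraction of the energy lost in a window; \<open>shear\<close> controls the growth of the inviscid
  solution in \<open>H\<^sup>1\<close> and \<open>mixing\<close> its decay in the dual norm.  In the proof the correlation is
  compared with the energy through the monotone function \<open>F - \<epsilon> / 2 N + \<nu> G / (4 \<epsilon>) s\<close>, which avoids
  integrals in time.
\<close>

lemma window_decay:
  fixes a \<tau> d w :: real
  defines "K \<equiv> \<bar>of_int k\<bar> :: real"
  assumes mix: "mixing_bound \<alpha> a" and a: "0 < a" and w: "0 \<le> w" and \<tau>: "0 < \<tau>"
    and d: "0 < d" "d \<le> 1 / 64"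
    and shear: "d * \<nu> * \<alpha>\<^sup>2 * K\<^sup>2 * \<tau> ^ 3 \<le> 1 / 64"
    and mixing: "a * (K * \<tau> / 2) powr (- p_exp \<alpha>) * (d / (\<nu> * \<tau>)) \<le> 1 / 16"
  shows "(H_norm (f (w + 2 * \<tau>)))\<^sup>2 \<le> (1 - d) * (H_norm (f w))\<^sup>2"
proof (rule ccontr)
  assume contra: "\<not> ?thesis"
  define N where "N s = (H_norm (f s))\<^sup>2" for s
  define E where "E s = (H1_norm k (f s))\<^sup>2" for s
  define D where "D = d * N w"
  have N_nonneg: "0 \<le> N s" and E_nonneg: "0 \<le> E s" for s by (simp_all add: N_def E_def)
  have K: "0 < K" using k by (simp add: K_def)
  have anti: "N v \<le> N u" if "0 \<le> u" "u \<le> v" for u v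
    unfolding N_def using that by (rule energy_antimono)
  have end_gt: "N (w + 2 * \<tau>) > N w - D"
    using contra by (simp add: N_def D_def algebra_simps)
  \<comment> \<open>By monotonicity, no subinterval of the window loses more than \<open>D\<close>,
    the loss assumed not to be reached.\<close>
  have drop: "N u - N v \<le> D" if "w \<le> u" "u \<le> v" "v \<le> w + 2 * \<tau>" for u v
  proof -
    have "N u \<le> N w" using w that by (intro anti) auto
    moreover have "N (w + 2 * \<tau>) \<le> N v" using w that by (intro anti) auto
    ultimately show ?thesis using end_gt by linarith
  qed
  have Nw: "0 < N w"
  proof (rule ccontr)
    assume "\<not> 0 < N w"
    then have "N w = 0" using N_nonneg[of w] by simp
    moreover have "N (w + 2 * \<tau>) \<le> N w" using w \<tau> by (intro anti) auto
    ultimately show False using end_gt by (simp add: D_def)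
  qed
  have "w < w + \<tau>" using \<tau> by simp
  then obtain t1 where t1: "w < t1" "t1 < w + \<tau>" "N w - N (w + \<tau>) = 2 * \<nu> * \<tau> * E t1"
    using energy_mvt[OF w, of "w + \<tau>"] unfolding N_def E_def by (metis add_diff_cancel_left')
  \<comment> \<open>Waiting at least \<open>\<tau> / 2\<close> after \<open>t1\<close> gives mixing
    time to act, while \<open>t1 + \<tau>\<close> still lies in the window.\<close>
  have "0 \<le> t1 + \<tau> / 2" "t1 + \<tau> / 2 < t1 + \<tau>" using w t1 \<tau> by auto
  then obtain t2 where t2: "t1 + \<tau> / 2 < t2" "t2 < t1 + \<tau>"
      "N (t1 + \<tau> / 2) - N (t1 + \<tau>) = 2 * \<nu> * (\<tau> / 2) * E t2"
  proof -
    assume *: thesis if "t1 + \<tau> / 2 < t2" "t2 < t1 + \<tau>"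
      "N (t1 + \<tau> / 2) - N (t1 + \<tau>) = 2 * \<nu> * (\<tau> / 2) * E t2" for t2
    obtain z where z: "t1 + \<tau> / 2 < z" "z < t1 + \<tau>"
        "(H_norm (f (t1 + \<tau> / 2)))\<^sup>2 - (H_norm (f (t1 + \<tau>)))\<^sup>2
          = 2 * \<nu> * ((t1 + \<tau>) - (t1 + \<tau> / 2)) * (H1_norm k (f z))\<^sup>2"
      using energy_mvt[OF \<open>0 \<le> t1 + \<tau> / 2\<close> \<open>t1 + \<tau> / 2 < t1 + \<tau>\<close>] by blast
    have "(t1 + \<tau>) - (t1 + \<tau> / 2) = \<tau> / 2" by simp
    with z show thesis unfolding N_def[symmetric] E_def[symmetric] by (intro *[of z]) (simp_all only:)
  qed
  have E1: "2 * (\<nu> * \<tau> * E t1) \<le> D" using drop[of w "w + \<tau>"] t1 \<tau> by (simp add: mult_ac)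
  have E2: "\<nu> * \<tau> * E t2 \<le> D" using drop[of "t1 + \<tau> / 2" "t1 + \<tau>"] t1 t2 \<tau> by (simp add: mult_ac)
  have pos: "0 < t1" "0 < t2" "t1 < t2" using w t1 t2 \<tau> by auto
  note \<phi> = solution_domain(2,3)[OF pos(1)] solution_H_space[OF less_imp_le[OF pos(1)]]
  define g where "g s = inviscid \<alpha> k (f t1) (s - t1)" for s
  define F where "F s = Re (H_inner (f s) (g s))" for s
  \<comment> \<open>With this value \<open>\<epsilon> / 2 * D\<close> is exactly
    \<open>N w / 4\<close>.\<close>
  define \<epsilon> where "\<epsilon> = 1 / (2 * d)"
  define G where "G = 2 * E t1 + 2 * \<alpha>\<^sup>2 * K\<^sup>2 * \<tau>\<^sup>2 * N w"
  have \<epsilon>: "0 < \<epsilon>" using d by (simp add: \<epsilon>_def)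
  have Nt1: "N t1 \<le> N w" using w t1 by (intro anti) auto
  have gG: "(H1_norm k (g s))\<^sup>2 \<le> G" if "t1 \<le> s" "s \<le> t2" for s
  proof -
    have "(s - t1)\<^sup>2 \<le> \<tau>\<^sup>2" using that t2 by (intro power_mono) auto
    then have "(2 * \<alpha>\<^sup>2 * K\<^sup>2) * ((s - t1)\<^sup>2 * N t1) \<le> (2 * \<alpha>\<^sup>2 * K\<^sup>2) * (\<tau>\<^sup>2 * N w)"
      using Nt1 N_nonneg by (intro mult_left_mono mult_mono) auto
    then show ?thesis
      using inviscid_H1(3)[OF \<phi> \<alpha>, of "s - t1"]
      by (simp add: g_def G_def E_def[symmetric] N_def[symmetric] K_def mult.assoc)
  qed
  have rearrange: "x - y \<le> e * (u - v) + c * (r' - r)"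
    if "x - e * u + c * r \<le> y - e * v + c * r'" for x y e u v c r r' :: real
    using that by (simp add: algebra_simps)
  \<comment> \<open>As \<open>N' = - 2 \<nu> E\<close>, the term with \<open>N\<close> contributes
    \<open>\<epsilon> \<nu> E\<close> to the derivative and the linear term contributes
    \<open>\<nu> G / (4 \<epsilon>)\<close>; together they offset Young's bound for the loss of
    correlation.\<close>
  have "F t1 - \<epsilon> / 2 * N t1 + \<nu> * G / (4 * \<epsilon>) * t1 \<le> F t2 - \<epsilon> / 2 * N t2 + \<nu> * G / (4 * \<epsilon>) * t2"
  proof (rule DERIV_nonneg_imp_nondecreasing[OF less_imp_le[OF pos(3)]])
    fix s assume s: "t1 \<le> s" "s \<le> t2"
    let ?P = "Re (integral\<^sup>L leb01 (H1_pair k (f s) (g s)))"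
    have s0: "0 < s" using s pos by simp
    have "((\<lambda>s. F s - \<epsilon> / 2 * N s + \<nu> * G / (4 * \<epsilon>) * s) has_real_derivative
        (- \<nu> * ?P) - \<epsilon> / 2 * (- 2 * \<nu> * E s) + \<nu> * G / (4 * \<epsilon>) * 1) (at s)"
      unfolding F_def N_def E_def g_def
      by (intro DERIV_add DERIV_diff DERIV_cmult DERIV_ident correlation_deriv energy_deriv \<phi> s0)
    moreover have "0 \<le> (- \<nu> * ?P) - \<epsilon> / 2 * (- 2 * \<nu> * E s) + \<nu> * G / (4 * \<epsilon>) * 1"
    proof -
      have "?P \<le> \<epsilon> * E s + (H1_norm k (g s))\<^sup>2 / (4 * \<epsilon>)"
        unfolding E_def g_def
        by (intro Re_H1_pair_le solution_domain s0 inviscid_H1 \<phi> \<alpha> \<epsilon>)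
      also have "\<dots> \<le> \<epsilon> * E s + G / (4 * \<epsilon>)"
        using gG[OF s] \<epsilon> by (intro add_left_mono divide_right_mono) auto
      finally have "\<nu> * ?P \<le> \<nu> * (\<epsilon> * E s + G / (4 * \<epsilon>))" using \<nu> by (intro mult_left_mono) auto
      then show ?thesis by (simp add: algebra_simps)
    qed
    ultimately show "\<exists>y. ((\<lambda>s. F s - \<epsilon> / 2 * N s + \<nu> * G / (4 * \<epsilon>) * s) has_real_derivative y) (at s) \<and> 0 \<le> y"
      by blast
  qed
  then have "F t1 - F t2 \<le> \<epsilon> / 2 * (N t1 - N t2) + \<nu> * G / (4 * \<epsilon>) * (t2 - t1)"
    by (rule rearrange)
  moreover have "F t1 = N t1"
    by (simp add: F_def g_def inviscid_def[abs_def] N_def H_inner_self del: of_real_power)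
  moreover have "\<epsilon> / 2 * (N t1 - N t2) \<le> N w / 4"
  proof -
    have "\<epsilon> / 2 * (N t1 - N t2) \<le> \<epsilon> / 2 * D"
      using drop[of t1 t2] t1 t2 \<epsilon> by (intro mult_left_mono) auto
    also have "\<dots> = N w / 4" using d by (simp add: \<epsilon>_def D_def)
    finally show ?thesis .
  qed
  moreover have "\<nu> * G / (4 * \<epsilon>) * (t2 - t1) \<le> N w / 32"
  proof -
    have G0: "0 \<le> G" using E_nonneg N_nonneg by (simp add: G_def)
    have "\<nu> * G / (4 * \<epsilon>) * (t2 - t1) \<le> \<nu> * G / (4 * \<epsilon>) * \<tau>"
      using t2 \<nu> G0 \<epsilon> by (intro mult_left_mono) auto
    also have "\<dots> = d * (\<nu> * \<tau> * E t1) + (d * \<nu> * \<alpha>\<^sup>2 * K\<^sup>2 * \<tau> ^ 3) * N w"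
      using d by (simp add: \<epsilon>_def G_def field_simps power2_eq_square power3_eq_cube)
    also have "\<dots> \<le> 1 / 64 * (N w) + 1 / 64 * N w"
    proof (intro add_mono mult_right_mono shear N_nonneg)
      have "\<nu> * \<tau> * E t1 \<le> D" using E1 \<nu> \<tau> E_nonneg[of t1] by (smt (verit) mult_nonneg_nonneg)
      also have "D \<le> 1 * N w" unfolding D_def using d N_nonneg by (intro mult_right_mono) auto
      finally have "\<nu> * \<tau> * E t1 \<le> N w" by simp
      then show "d * (\<nu> * \<tau> * E t1) \<le> 1 / 64 * N w"
        using d \<nu> \<tau> E_nonneg[of t1] by (intro mult_mono) auto
    qed
    finally show ?thesis by simp
  qed
  moreover have "F t2 \<le> N w / 16"
  proof -
    \<comment> \<open>The mixing estimate divides by the \<open>H^1\<close> norm at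
      \<open>t2\<close>, which dominates the \<open>H\<close> norm there.\<close>
    have Nt2: "0 < N t2"
    proof -
      have "N (w + 2 * \<tau>) \<le> N t2" using pos t1 t2 by (intro anti) auto
      moreover have "D \<le> 1 * N w" unfolding D_def using d N_nonneg by (intro mult_right_mono) auto
      ultimately show ?thesis using end_gt by linarith
    qed
    then have "0 < H_norm (f t2)" using H_norm_nonneg[of "f t2"] by (simp add: N_def less_le)
    then have H1pos: "0 < H1_norm k (f t2)"
      using H_norm_le_H1_norm[OF k solution_domain(2)[OF pos(2)] solution_H_space] pos by force
    have Kt: "K * \<tau> / 2 \<le> 1 + K * (t2 - t1)"
    proof -
      have "K * (\<tau> / 2) \<le> K * (t2 - t1)" using K t2 by (intro mult_left_mono) auto
      then show ?thesis by simp
    qed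
    have p: "0 < p_exp \<alpha>" by (simp add: p_exp_def)
    have "F t2 \<le> cmod (H_inner (f t2) (g t2))" unfolding F_def by (rule complex_Re_le_cmod)
    also have "\<dots> = cmod (H_inner (g t2) (f t2))" by (subst H_inner_cnj) simp
    also have "\<dots> \<le> a * (1 + K * (t2 - t1)) powr (- p_exp \<alpha>) * H1_norm k (f t1) * H1_norm k (f t2)"
      unfolding g_def K_def
      by (intro mixing_bound_inner mix k \<phi> solution_domain H1pos) (use pos in auto)
    also have "\<dots> = (a * (1 + K * (t2 - t1)) powr (- p_exp \<alpha>)) * (H1_norm k (f t1) * H1_norm k (f t2))"
      by simp
    \<comment> \<open>The elapsed time is at least \<open>\<tau> / 2\<close>, and \<open>E1\<close>,
      \<open>E2\<close> bound the product of the two \<open>H^1\<close> norms.\<close>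
    also have "\<dots> \<le> (a * (K * \<tau> / 2) powr (- p_exp \<alpha>)) * (D / (\<nu> * \<tau>))"
    proof (rule mult_mono)
      show "a * (1 + K * (t2 - t1)) powr (- p_exp \<alpha>) \<le> a * (K * \<tau> / 2) powr (- p_exp \<alpha>)"
        using Kt K \<tau> p a by (intro mult_left_mono powr_mono2') auto
      have "2 * (H1_norm k (f t1) * H1_norm k (f t2)) \<le> E t1 + E t2"
        using sum_squares_bound[of "H1_norm k (f t1)" "H1_norm k (f t2)"] by (simp add: E_def)
      then have "(\<nu> * \<tau>) * (2 * (H1_norm k (f t1) * H1_norm k (f t2))) \<le> (\<nu> * \<tau>) * (E t1 + E t2)"
        using \<nu> \<tau> by (intro mult_left_mono) auto
      then have "2 * ((\<nu> * \<tau>) * (H1_norm k (f t1) * H1_norm k (f t2))) \<le> \<nu> * \<tau> * E t1 + \<nu> * \<tau> * E t2"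
        by (simp add: algebra_simps)
      moreover have "0 \<le> D" using d N_nonneg by (simp add: D_def)
      ultimately have "(\<nu> * \<tau>) * (H1_norm k (f t1) * H1_norm k (f t2)) \<le> D" using E1 E2 by linarith
      then show "H1_norm k (f t1) * H1_norm k (f t2) \<le> D / (\<nu> * \<tau>)"
        using \<nu> \<tau> by (simp add: pos_le_divide_eq mult_ac)
    qed (use a in auto)
    also have "\<dots> = (a * (K * \<tau> / 2) powr (- p_exp \<alpha>) * (d / (\<nu> * \<tau>))) * N w"
      by (simp add: D_def)
    also have "\<dots> \<le> 1 / 16 * N w" using mixing N_nonneg by (intro mult_right_mono) auto
    finally show ?thesis by simp
  qed
  moreover have "N t1 \<ge> N w - 1 / 64 * N w"
  proof -
    have "N w - N t1 \<le> D" using drop[of w t1] t1 \<tau> by auto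
    also have "D \<le> 1 / 64 * N w" unfolding D_def using d N_nonneg by (intro mult_right_mono) auto
    finally show ?thesis by simp
  qed
  \<comment> \<open>The correlation at \<open>t1\<close> is at least \<open>63 / 64\<close> of
    \<open>N w\<close>, whereas the bounds allow at most
    \<open>1 / 16 + 1 / 4 + 1 / 32 = 11 / 32\<close>.\<close>
  ultimately show False using Nw by linarith
qed

end


section \<open>Choice of the time scale and iteration over windows\<close>

lemma viscous_decay:
  assumes vs: "viscous_solution \<alpha> k \<nu> f\<^sub>0 f" and \<alpha>: "1 \<le> \<alpha>" and a: "0 < a" and mix: "mixing_bound \<alpha> a"
    and k: "k \<noteq> 0" and \<nu>: "0 < \<nu>" and small: "\<nu> / \<bar>of_int k\<bar> < 1"
  defines "\<mu> \<equiv> \<nu> powr q_exp \<alpha> * \<bar>of_int k\<bar> powr (1 - q_exp \<alpha>)"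
  assumes t: "1 / \<mu> < t"
  shows "H_norm (f t) \<le> exp (- (c_rate \<alpha> a * \<mu> * t)) * H_norm (f 0)"
proof -
  define K where "K = (\<bar>of_int k\<bar> :: real)"
  define p q where "p = p_exp \<alpha>" and "q = q_exp \<alpha>"
  define x where "x = \<nu> / K"
  \<comment> \<open>The exponent is fixed by the two balances \<open>X4\<close> and
    \<open>Xp\<close> below: the first enters the shear condition, the second the mixing
    condition.\<close>
  define X where "X = x powr (2 / (4 + p))"
  \<comment> \<open>Twice the rate, because the argument works with squared norms.\<close>
  define \<delta> where "\<delta> = 2 * c_rate \<alpha> a"
  define \<tau> where "\<tau> = 1 / (2 * K * X)"
  \<comment> \<open>A window of length \<open>2 * \<tau>\<close> at rate
    \<open>\<delta> * \<mu>\<close> would need only half of this; the extra factor \<open>2\<close>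
    pays for rounding the number of windows down.\<close>
  define d where "d = 4 * \<tau> * \<delta> * \<mu>"
  have K1: "1 \<le> K"
  proof -
    have "1 \<le> \<bar>k\<bar>" using k by linarith
    then have "real_of_int 1 \<le> of_int \<bar>k\<bar>" by (simp only: of_int_le_iff)
    then show ?thesis by (simp add: K_def)
  qed
  have x: "0 < x" "x < 1" using \<nu> K1 small by (auto simp: x_def K_def)
  have X: "0 < X" using x by (simp add: X_def)
  have p: "0 < p" "p \<le> 1" by (auto simp: p_def p_exp_def field_simps)
  have q: "q = (4 - p) / (4 + p)" by (simp add: q_def q_exp_def p_def)
  have \<mu>: "\<mu> = K * x powr q"
  proof -
    have "\<nu> = x * K" using K1 by (simp add: x_def)
    then have "\<mu> = (x * K) powr q * K powr (1 - q)" by (simp add: \<mu>_def q_def K_def)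
    also have "\<dots> = x powr q * (K powr q * K powr (1 - q))" using x K1 by (simp add: powr_mult)
    also have "K powr q * K powr (1 - q) = K" using K1 by (simp add: powr_add[symmetric])
    finally show ?thesis by simp
  qed
  have \<mu>0: "0 < \<mu>" using K1 x by (simp add: \<mu>)
  have X4: "x powr q * x = X ^ 4"
  proof -
    have "x powr q * x = x powr (q + 1)" using x by (simp add: powr_add)
    also have "q + 1 = (2 / (4 + p)) * real 4" using p by (simp add: q field_simps)
    also have "x powr \<dots> = X powr real 4" unfolding X_def by (rule powr_powr[symmetric])
    also have "\<dots> = X ^ 4" using X by (rule powr_realpow)
    finally show ?thesis .
  qed
  have Xp: "X powr p * x powr q = x"
  proof -
    have "X powr p * x powr q = x powr (2 / (4 + p) * p + q)" by (simp add: X_def powr_powr powr_add)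
    also have "2 / (4 + p) * p + q = 1"
      using p by (simp add: q add_divide_distrib[symmetric])
    finally show ?thesis using x by simp
  qed
  \<comment> \<open>For \<open>x < 1\<close> the larger exponent gives the smaller power. The
    consequence is that a window is no longer than \<open>1 / \<mu>\<close>, so at least one full
    window precedes \<open>t\<close>.\<close>
  have qX: "x powr q \<le> X"
  proof -
    have "2 / (4 + p) \<le> q" unfolding q using p by (intro divide_right_mono) auto
    then show ?thesis unfolding X_def using x by (intro powr_mono') auto
  qed
  have \<tau>0: "0 < \<tau>" using K1 X by (simp add: \<tau>_def)
  have \<tau>\<mu>: "2 * \<tau> * \<mu> \<le> 1"
    using K1 X qX by (simp add: \<tau>_def \<mu> field_simps)
  \<comment> \<open>The two entries of the minimum in \<open>c_rate\<close>: \<open>m1\<close>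
    secures the shear condition and \<open>d \<le> 1 / 64\<close>, \<open>m2\<close> the mixing
    condition.\<close>
  define m1 m2 where "m1 = 1 / (64 * (1 + \<alpha>\<^sup>2))" and "m2 = 1 / (a * 4 powr p)"
  have \<delta>_eq: "\<delta> = min m1 m2 / 64" by (simp add: \<delta>_def c_rate_def m1_def m2_def p_def)
  have m: "0 < m1" "0 < m2" using a by (auto simp: m1_def m2_def add_pos_nonneg)
  have m1: "m1 \<le> 1 / 64" "m1 * \<alpha>\<^sup>2 \<le> 1 / 64"
  proof -
    have "0 < 1 + \<alpha>\<^sup>2" by (simp add: add_pos_nonneg)
    then show "m1 \<le> 1 / 64" "m1 * \<alpha>\<^sup>2 \<le> 1 / 64" by (simp_all add: m1_def field_simps)
  qed
  have \<delta>: "0 < \<delta>" "\<delta> \<le> m1 / 64" "\<delta> \<le> m2 / 64" using m by (auto simp: \<delta>_eq)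
  have d0: "0 < d" using \<tau>0 \<delta> \<mu>0 by (simp add: d_def)
  have "d = (2 * \<tau> * \<mu>) * (2 * \<delta>)" by (simp add: d_def)
  also have "\<dots> \<le> 1 * (2 * \<delta>)" using \<tau>\<mu> \<delta> by (intro mult_right_mono) auto
  finally have d1: "d \<le> 1 / 64" using \<delta> m1 by simp
  have shear: "d * \<nu> * \<alpha>\<^sup>2 * K\<^sup>2 * \<tau> ^ 3 \<le> 1 / 64"
  proof -
    have "\<nu> = x * K" using K1 by (simp add: x_def)
    \<comment> \<open>All powers of \<open>\<nu>\<close> and \<open>k\<close> cancel, since
      \<open>X * K * \<tau> = 1 / 2\<close>; what remains is
      \<open>\<delta> * \<alpha>^2 / 4\<close>.\<close>
    then have "d * \<nu> * \<alpha>\<^sup>2 * K\<^sup>2 * \<tau> ^ 3 = 4 * \<delta> * \<alpha>\<^sup>2 * (x powr q * x) * (K * \<tau>) ^ 4"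
      by (simp add: d_def \<mu> power4_eq_xxxx power3_eq_cube power2_eq_square)
    also have "\<dots> = 4 * \<delta> * \<alpha>\<^sup>2 * (X * (K * \<tau>)) ^ 4"
      by (simp add: X4 power_mult_distrib)
    also have "X * (K * \<tau>) = 1 / 2" using K1 X by (simp add: \<tau>_def)
    also have "4 * \<delta> * \<alpha>\<^sup>2 * (1 / 2) ^ 4 = \<delta> * \<alpha>\<^sup>2 / 4" by (simp add: power4_eq_xxxx)
    also have "\<dots> \<le> (m1 / 64) * \<alpha>\<^sup>2 / 4" using \<delta> by (intro divide_right_mono mult_right_mono) auto
    also have "\<dots> \<le> 1 / 64" using m1(2) by simp
    finally show ?thesis .
  qed
  have mixing: "a * (K * \<tau> / 2) powr (- p) * (d / (\<nu> * \<tau>)) \<le> 1 / 16"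
  proof -
    have "(K * \<tau> / 2) powr (- p) = (4 * X) powr p"
    proof -
      have inv: "inverse y powr (- p) = y powr p" if "0 < y" for y :: real
        using that by (simp add: powr_minus inverse_powr)
      \<comment> \<open>This is the origin of the factor \<open>4 powr p\<close> in
        \<open>c_rate\<close>.\<close>
      have eq: "K * \<tau> / 2 = inverse (4 * X)" using K1 X by (simp add: \<tau>_def field_simps)
      show ?thesis unfolding eq using X by (intro inv) simp
    qed
    also have "\<dots> = 4 powr p * X powr p" using X by (simp add: powr_mult)
    finally have 1: "(K * \<tau> / 2) powr (- p) = 4 powr p * X powr p" .
    have "d / (\<nu> * \<tau>) = 4 * \<delta> * (x powr q / x)"
      using \<tau>0 K1 x by (simp add: d_def \<mu> x_def field_simps)
    then have "a * (K * \<tau> / 2) powr (- p) * (d / (\<nu> * \<tau>)) = 4 * \<delta> * (a * 4 powr p) * ((X powr p * x powr q) / x)"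
      unfolding 1 by simp
    also have "\<dots> = 4 * \<delta> * (a * 4 powr p)" using Xp x by simp
    also have "\<dots> \<le> 4 * (m2 / 64) * (a * 4 powr p)" using \<delta> a by (intro mult_right_mono) auto
    also have "\<dots> = 1 / 16" using a by (simp add: m2_def)
    finally show ?thesis .
  qed
  have step: "(H_norm (f (w + 2 * \<tau>)))\<^sup>2 \<le> (1 - d) * (H_norm (f w))\<^sup>2" if "0 \<le> w" for w
    by (rule window_decay[OF vs \<alpha> k \<nu> mix a that \<tau>0 d0 d1])
       (use shear mixing in \<open>simp_all add: K_def p_def\<close>)
  have iter: "(H_norm (f (real n * (2 * \<tau>))))\<^sup>2 \<le> (1 - d) ^ n * (H_norm (f 0))\<^sup>2" for n
  proof (induction n)
    case (Suc n)
    have "(H_norm (f (real n * (2 * \<tau>) + 2 * \<tau>)))\<^sup>2 \<le> (1 - d) * (H_norm (f (real n * (2 * \<tau>))))\<^sup>2"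
      using \<tau>0 by (intro step) auto
    also have "\<dots> \<le> (1 - d) * ((1 - d) ^ n * (H_norm (f 0))\<^sup>2)"
      using Suc.IH d1 by (intro mult_left_mono) auto
    finally show ?case by (simp add: algebra_simps)
  qed simp
  have t0: "0 < t" using t \<mu>0 by (smt (verit) zero_less_divide_1_iff)
  define y where "y = t / (2 * \<tau>)"
  define n where "n = nat \<lfloor>y\<rfloor>"
  have y1: "1 \<le> y"
  proof -
    have "2 * \<tau> \<le> 1 / \<mu>" using \<tau>\<mu> \<mu>0 by (simp add: pos_le_divide_eq)
    then show ?thesis using t \<tau>0 by (simp add: y_def)
  qed
  \<comment> \<open>Rounding down loses at most half because \<open>y \<ge> 1\<close>. The leftover
    time after the last full window is covered by monotonicity of the energy.\<close>
  have n: "real n \<le> y" "y / 2 \<le> real n"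
  proof -
    have r: "real n = of_int \<lfloor>y\<rfloor>" using y1 by (simp add: n_def)
    show "real n \<le> y" unfolding r by simp
    have "1 \<le> \<lfloor>y\<rfloor>" using y1 by simp
    then have "1 \<le> real n" unfolding r by simp
    moreover have "y < real n + 1" unfolding r by simp
    ultimately show "y / 2 \<le> real n" by linarith
  qed
  have "(H_norm (f t))\<^sup>2 \<le> (H_norm (f (real n * (2 * \<tau>))))\<^sup>2"
  proof (rule energy_antimono[OF vs \<alpha> k \<nu>])
    show "real n * (2 * \<tau>) \<le> t" using n(1) \<tau>0 by (simp add: y_def pos_le_divide_eq)
  qed (use \<tau>0 in simp)
  also have "\<dots> \<le> (1 - d) ^ n * (H_norm (f 0))\<^sup>2" by (rule iter)
  also have "\<dots> \<le> exp (- (2 * c_rate \<alpha> a * \<mu> * t)) * (H_norm (f 0))\<^sup>2"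
  proof (intro mult_right_mono)
    have "(1 - d) ^ n \<le> exp (- d) ^ n"
      using exp_ge_add_one_self[of "- d"] d1 by (intro power_mono) auto
    also have "\<dots> = exp (- (d * real n))" by (simp add: exp_of_nat_mult[symmetric] mult.commute)
    also have "\<dots> \<le> exp (- (d * (y / 2)))" using n(2) d0 by simp
    also have "d * (y / 2) = 2 * c_rate \<alpha> a * \<mu> * t" using \<tau>0 by (simp add: d_def y_def \<delta>_def)
    finally show "(1 - d) ^ n \<le> exp (- (2 * c_rate \<alpha> a * \<mu> * t))" .
  qed simp
  also have "\<dots> = (exp (- (c_rate \<alpha> a * \<mu> * t)) * H_norm (f 0))\<^sup>2"
    by (simp add: power_mult_distrib exp_double[symmetric] mult.assoc)
  finally show ?thesis by (rule power2_le_imp_le) simp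
qed

text \<open>The initial datum is attained only almost everywhere, so its norm has to be identified
  with that of \<open>f 0\<close>.\<close>

lemma H_norm_cong_AE:
  assumes "AE r in lebesgue. r \<in> {0<..<1} \<longrightarrow> x r = y r" "x \<in> H_space" "y \<in> H_space"
  shows "H_norm x = H_norm y"
proof -
  have "AE r in leb01. x r = y r"
    using assms(1) by (subst AE_restrict_space_iff) auto
  then show ?thesis
    unfolding H_norm_eq using assms(2,3)
    by (intro arg_cong[of _ _ sqrt] integral_cong_AE) (auto simp: H_space_iff elim: eventually_mono)
qed

theorem theorem5p3:
  fixes \<alpha> a \<nu> :: real and k :: int
    and f_in :: "real \<Rightarrow> complex" and f :: "real \<Rightarrow> real \<Rightarrow> complex"
  assumes "\<alpha> \<ge> 1" and "a > 0" and "mixing_bound \<alpha> a"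
    and "k \<noteq> 0" and "0 < \<nu>" and "\<nu> < 1" and "\<nu> / \<bar>of_int k\<bar> < 1"
    and "f_in \<in> H_space" and "viscous_solution \<alpha> k \<nu> f_in f"
  shows "\<forall>t. t > 1 / (\<nu> powr q_exp \<alpha> * \<bar>of_int k\<bar> powr (1 - q_exp \<alpha>)) \<longrightarrow>
    H_norm (f t) \<le>
      exp (- (c_rate \<alpha> a * \<nu> powr q_exp \<alpha> * \<bar>of_int k\<bar> powr (1 - q_exp \<alpha>) * t)) * H_norm f_in"
proof (intro allI impI)
  fix t assume t: "1 / (\<nu> powr q_exp \<alpha> * \<bar>of_int k\<bar> powr (1 - q_exp \<alpha>)) < t"
  have "H_norm (f 0) = H_norm f_in"
    using assms(8,9) by (intro H_norm_cong_AE) (auto simp: viscous_solution_def)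
  then show "H_norm (f t) \<le>
      exp (- (c_rate \<alpha> a * \<nu> powr q_exp \<alpha> * \<bar>of_int k\<bar> powr (1 - q_exp \<alpha>) * t)) * H_norm f_in"
    using viscous_decay[OF assms(9,1,2,3,4,5,7) t] by (simp add: mult.assoc)
qed

end
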